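(* Let $1<p\le q<+\infty$, $p'=\frac{p}{p-1}$, $s\in(1,p)$, and let $g$ be a real continuous strictly monotone function on $(a,b)$, where $-\infty\le a<b\le+\infty$, that is either convex decreasing or concave increasing. Let $w$ be a strictly positive measurable function on $(0,+\infty)$ such that $W(x)=\int_0^x w(t)\,\mathrm{d}t$ is finite for each $x>0$ and $W(+\infty)=+\infty$, let $u,v$ be weights on $(0,+\infty)$, and put $$U(x):=\frac{u\left(W^{-1}(x)\right)}{W'\left(W^{-1}(x)\right)},\qquad V(x):=\frac{v\left(W^{-1}(x)\right)}{W'\left(W^{-1}(x)\right)},\qquad \widetilde V(t):=\int_0^t V(y)^{1-p'}\,\mathrm{d}y,$$ and, for $s\in(1,p)$, $$A(s):=\sup_{t>0}\widetilde V(t)^{\frac{s-1}{p}}\left(\int_t^\infty U(x)\,\widetilde V(x)^{\frac{q(p-s)}{p}}\,\frac{\mathrm{d}x}{x^q}\right)^{1/q}.$$ If $A(s)<+\infty$, then there is a positive finite constant $C$ such that the inequality $$\left(\int_0^\infty u(x)\Bigl([\mathbf{M}^g_w f](x)\Bigr)^q\,\mathrm{d}x\right)^{1/q}\le C\left(\int_0^\infty v(x)f(x)^p\,\mathrm{d}x\right)^{1/p}$$ holds for all non-negative measurable $f$ on $(0,+\infty)$ such that $a<f(x)<b$ for all $x$ and $\mathbf{M}^g_w f$ is defined. Moreover, if $C$ is the best possible constant in this inequality, then $$C\le\inf_{1<s<p}\left(\frac{p-1}{p-s}\right)^{1/p'}A(s).$$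
   Context: A weight on $(0,+\infty)$ is a positive measurable function. The generalized weighted mean operator is $$[\mathbf{M}^g_w f](x)=g^{-1}\left(\frac{1}{W(x)}\int_0^x w(t)\,g(f(t))\,\mathrm{d}t\right),\quad x>0,$$ defined when $f$ takes values in the domain of $g$ and $w\cdot(g\circ f)$ is integrable on $(0,x)$ for every $x>0$. $W^{-1}$ is the inverse function of $W$ and $W'$ its derivative (equal to $w$ almost everywhere). The best possible constant is the infimum of all constants for which the inequality holds for all admissible $f$. Integrals of non-negative functions take values in $[0,+\infty]$. *)

theory Defs
  imports "HOL-Analysis.Analysis"
begin

text \<open>Weights on the half-line. ``Measurable'' is Lebesgue measurable throughout.\<close>

definition weight :: "(real \<Rightarrow> real) \<Rightarrow> bool" where
  "weight w \<longleftrightarrow> w \<in> borel_measurable (lebesgue_on {0<..}) \<and> (\<forall>x>0. 0 < w x)"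

text \<open>Real powers on \<open>[0, \<infinity>]\<close>; only used with exponents \<open>r > 0\<close>.\<close>

definition epowr :: "ennreal \<Rightarrow> real \<Rightarrow> ennreal" where
  "epowr x r = (if x = \<infinity> then \<infinity> else ennreal (enn2real x powr r))"

definition conj_exp :: "real \<Rightarrow> real" where
  "conj_exp p = p / (p - 1)"

definition cumul :: "(real \<Rightarrow> real) \<Rightarrow> real \<Rightarrow> real" where
  "cumul w x = (LINT t:{0<..<x}|lebesgue. w t)"

definition cumul_inv :: "(real \<Rightarrow> real) \<Rightarrow> real \<Rightarrow> real" where
  "cumul_inv w = the_inv_into {0<..} (cumul w)"

text \<open>The transported weight \<open>u(W\<^sup>-\<^sup>1(x)) / W'(W\<^sup>-\<^sup>1(x))\<close>, giving \<open>U\<close> from \<open>u\<close> and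
  \<open>V\<close> from \<open>v\<close>. On the null set where \<open>W\<close> is not differentiable or \<open>W' = 0\<close> its
  value is irrelevant.\<close>

definition transport :: "(real \<Rightarrow> real) \<Rightarrow> (real \<Rightarrow> real) \<Rightarrow> real \<Rightarrow> real" where
  "transport w u x = u (cumul_inv w x) / deriv (cumul w) (cumul_inv w x)"

definition Vtilde :: "real \<Rightarrow> (real \<Rightarrow> real) \<Rightarrow> real \<Rightarrow> ennreal" where
  "Vtilde p V t = (\<integral>\<^sup>+y\<in>{0<..<t}. ennreal (V y powr (1 - conj_exp p)) \<partial>lebesgue)"

definition A_const ::
  "real \<Rightarrow> real \<Rightarrow> (real \<Rightarrow> real) \<Rightarrow> (real \<Rightarrow> real) \<Rightarrow> real \<Rightarrow> ennreal" where
  "A_const p q U V s =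
     (SUP t\<in>{0<..}. epowr (Vtilde p V t) ((s - 1) / p) *
        epowr (\<integral>\<^sup>+x\<in>{t<..}. ennreal (U x) * epowr (Vtilde p V x) (q * (p - s) / p)
                              / ennreal (x powr q) \<partial>lebesgue) (1 / q))"

text \<open>The generating function \<open>g\<close> is a function on the open interval \<open>einterval a b\<close> with
  extended real endpoints, and \<open>g\<^sup>-\<^sup>1\<close> is its inverse there.\<close>

definition wmean ::
  "ereal \<Rightarrow> ereal \<Rightarrow> (real \<Rightarrow> real) \<Rightarrow> (real \<Rightarrow> real) \<Rightarrow> (real \<Rightarrow> real) \<Rightarrow> real \<Rightarrow> real" where
  "wmean a b g w f x =
     the_inv_into (einterval a b) g
       (1 / cumul w x * (LINT t:{0<..<x}|lebesgue. w t * g (f t)))"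

definition wmean_defined ::
  "ereal \<Rightarrow> ereal \<Rightarrow> (real \<Rightarrow> real) \<Rightarrow> (real \<Rightarrow> real) \<Rightarrow> (real \<Rightarrow> real) \<Rightarrow> bool" where
  "wmean_defined a b g w f \<longleftrightarrow>
     (\<forall>x>0. f x \<in> einterval a b) \<and>
     (\<forall>x>0. set_integrable lebesgue {0<..<x} (\<lambda>t. w t * g (f t)))"

definition wmean_ineq ::
  "real \<Rightarrow> real \<Rightarrow> ereal \<Rightarrow> ereal \<Rightarrow> (real \<Rightarrow> real) \<Rightarrow> (real \<Rightarrow> real) \<Rightarrow>
   (real \<Rightarrow> real) \<Rightarrow> (real \<Rightarrow> real) \<Rightarrow> real \<Rightarrow> bool" where
  "wmean_ineq p q a b g w u v C \<longleftrightarrow>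
     (\<forall>f. f \<in> borel_measurable (lebesgue_on {0<..}) \<longrightarrow> (\<forall>x>0. 0 \<le> f x) \<longrightarrow>
          wmean_defined a b g w f \<longrightarrow>
        epowr (\<integral>\<^sup>+x\<in>{0<..}. ennreal (u x * wmean a b g w f x powr q) \<partial>lebesgue) (1 / q)
        \<le> ennreal C * epowr (\<integral>\<^sup>+x\<in>{0<..}. ennreal (v x * f x powr p) \<partial>lebesgue) (1 / p))"

text \<open>Infimum in \<open>[0, \<infinity>]\<close>, so \<open>\<infinity>\<close> if no constant is admissible.\<close>

definition best_const ::
  "real \<Rightarrow> real \<Rightarrow> ereal \<Rightarrow> ereal \<Rightarrow> (real \<Rightarrow> real) \<Rightarrow> (real \<Rightarrow> real) \<Rightarrow>
   (real \<Rightarrow> real) \<Rightarrow> (real \<Rightarrow> real) \<Rightarrow> ennreal" where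
  "best_const p q a b g w u v = Inf {ennreal C | C. 0 < C \<and> wmean_ineq p q a b g w u v C}"

end

theory Submission
  imports Defs "HOL-Probability.Probability"
begin

text \<open>
  By Jensen's inequality, \<open>M\<^sup>g\<^sub>w f(x)\<close> is at most the weighted arithmetic mean
  \<open>W(x)\<^sup>-\<^sup>1 \<integral>\<^sub>0\<^sup>x w f\<close>, so the claim is a weighted Hardy inequality. The substitution \<open>y = W(x)\<close>,
  which needs \<open>W' = w\<close> almost everywhere, turns \<open>Vtilde\<close> into
  \<open>\<sigma>(x) = \<integral>\<^sub>0\<^sup>x v\<^sup>1\<^sup>-\<^sup>p\<^sup>' w\<^sup>p\<^sup>'\<close> and removes the inverse of \<open>W\<close> from \<open>A(s)\<close>. Hoelder's inequality with
  the weight \<open>\<sigma>\<^sup>-\<^sup>\<theta> \<sigma>'\<close>, \<open>\<theta> = (s - 1) / (p - 1)\<close>, bounds \<open>(\<integral>\<^sub>0\<^sup>x w f)\<^sup>p\<close> by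
  \<open>((p - 1) / (p - s))\<^sup>p\<^sup>-\<^sup>1 \<sigma>(x)\<^sup>p\<^sup>-\<^sup>s \<integral>\<^sub>0\<^sup>x f\<^sup>p v \<sigma>\<^sup>s\<^sup>-\<^sup>1\<close>, and Minkowski's integral inequality with exponent
  \<open>q / p\<close> moves the outer integral inside, where it is controlled by \<open>A(s)\<close>.
\<close>

section \<open>Integrals over half-lines\<close>

text \<open>The constant comes from the mass of the Hoelder weight: s < p means \<theta> < 1, so
  \<sigma>^(-\<theta>) \<sigma>' is integrable at 0 and has mass \<rho> \<sigma>(x)^(1-\<theta>) on
  (0,x), where \<rho> = 1/(1-\<theta>) = (p-1)/(p-s). Hoelder's inequality contributes \<rho>^(p-1),
  and the p-th root of this is \<rho>^(1/p'). The obstacle is that A(s) sees W only through its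
  inverse and its derivative. Undoing the substitution requires that W' = w almost everywhere, for a
  w that is merely integrable on bounded intervals, and that W carries null sets to null sets. The
  former is a differentiation theorem resting on Vitali's covering theorem, the latter follows from
  the change of variables. Weights and f are only Lebesgue measurable. They are replaced by Borel
  versions wherever they occur under integrals, while M^g_w f is formed with the original f, whose
  values are known to lie in (a,b). Admissible constants must be strictly positive, so A(s) is
  replaced by A(s) + e, and e disappears in the infimum.\<close>

lemma nn_integral_Ioi_nonzero:
  fixes h :: "real \<Rightarrow> ennreal"
  assumes [measurable]: "h \<in> borel_measurable borel" and pos: "\<And>x. t < x \<Longrightarrow> h x \<noteq> 0"
  shows "(\<integral>\<^sup>+x\<in>{t<..}. h x \<partial>lborel) \<noteq> 0"
proof
  assume "(\<integral>\<^sup>+x\<in>{t<..}. h x \<partial>lborel) = 0"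
  then have "AE x in lborel. h x * indicator {t<..} x = 0"
    by (subst (asm) nn_integral_0_iff_AE) auto
  then have "AE x in lborel. x \<notin> {t<..<t + 1}"
    by eventually_elim (use pos in \<open>auto split: split_indicator_asm\<close>)
  then have "{t<..<t + 1} \<in> null_sets lborel"
    by (subst AE_iff_null_sets) auto
  then show False by (simp add: null_sets_def)
qed

text \<open>Redefining the Borel version as \<open>b\<close> wherever it leaves \<open>B\<close>
  makes the sign constraint hold at every point rather than almost everywhere. Weights use the
  positive half-line for \<open>B\<close>, functions f the nonnegative one.\<close>

lemma borel_representative_on_Ioi:
  fixes f :: "real \<Rightarrow> real"
  assumes f: "f \<in> borel_measurable (lebesgue_on {0<..})" and B: "B \<in> sets borel" "b \<in> B" "\<And>x. 0 < x \<Longrightarrow> f x \<in> B"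
  shows "\<exists>f0. f0 \<in> borel_measurable borel \<and> (\<forall>x. f0 x \<in> B) \<and> (AE x in lborel. 0 < x \<longrightarrow> f x = f0 x)"
proof -
  have "(\<lambda>x. indicator {0<..} x *\<^sub>R f x) \<in> borel_measurable (completion lborel)"
    using f by (subst (asm) borel_measurable_restrict_space_iff) auto
  from completion_ex_borel_measurable_real[OF this]
  obtain g where g: "g \<in> borel_measurable borel" "AE x in lborel. indicator {0<..} x *\<^sub>R f x = g x"
    by auto
  show ?thesis
  proof (intro exI conjI allI)
    show "(\<lambda>x. if g x \<in> B then g x else b) \<in> borel_measurable borel"
      using g(1) B(1) by measurable
    show "AE x in lborel. 0 < x \<longrightarrow> f x = (if g x \<in> B then g x else b)"
      using g(2) by eventually_elim (auto split: split_indicator_asm dest: B(3))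
    show "(if g x \<in> B then g x else b) \<in> B" for x
      using B(2) by simp
  qed
qed

lemma borel_measurable_nn_integral_Ioo [measurable]:
  fixes h :: "real \<Rightarrow> ennreal"
  assumes [measurable]: "h \<in> borel_measurable borel"
  shows "(\<lambda>x. \<integral>\<^sup>+t\<in>{0<..<x}. h t \<partial>lborel) \<in> borel_measurable borel"
proof -
  have "(\<lambda>x. \<integral>\<^sup>+t. (if 0 < t \<and> t < x then h t else 0) \<partial>lborel) \<in> borel_measurable borel"
    by measurable
  moreover have "(\<integral>\<^sup>+t. (if 0 < t \<and> t < x then h t else 0) \<partial>lborel) = (\<integral>\<^sup>+t\<in>{0<..<x}. h t \<partial>lborel)" for x
    by (intro nn_integral_cong) (auto split: split_indicator)
  ultimately show ?thesis by simp
qed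

text \<open>The exhausting sequence is arbitrary because a change of variables turns the cut-offs on
  one side into their images under the primitive on the other.\<close>

lemma nn_integral_Ioi_SUP:
  fixes h :: "real \<Rightarrow> ennreal" and c :: "nat \<Rightarrow> real"
  assumes [measurable]: "h \<in> borel_measurable borel" and c: "mono c" "\<And>y. \<exists>n. y < c n"
  shows "(\<integral>\<^sup>+x\<in>{0<..}. h x \<partial>lborel) = (SUP n. \<integral>\<^sup>+x\<in>{0<..<c n}. h x \<partial>lborel)"
proof -
  have "(SUP n. h x * indicator {0<..<c n} x) = h x * indicator {0<..} x" for x
  proof (rule antisym)
    show "(SUP n. h x * indicator {0<..<c n} x) \<le> h x * indicator {0<..} x"
      by (rule SUP_least) (auto split: split_indicator)
    obtain n where "x < c n" using c(2) by blast
    then show "h x * indicator {0<..} x \<le> (SUP n. h x * indicator {0<..<c n} x)"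
      by (intro SUP_upper2[of n]) (auto split: split_indicator)
  qed
  then have "(\<integral>\<^sup>+x\<in>{0<..}. h x \<partial>lborel) = (\<integral>\<^sup>+x. (SUP n. h x * indicator {0<..<c n} x) \<partial>lborel)"
    by simp
  also have "\<dots> = (SUP n. \<integral>\<^sup>+x\<in>{0<..<c n}. h x \<partial>lborel)"
  proof (rule nn_integral_monotone_convergence_SUP)
    show "incseq (\<lambda>n x. h x * indicator {0<..<c n} x)"
      using c(1) by (auto simp: incseq_def le_fun_def mono_def split: split_indicator) (meson less_le_trans)
  qed simp
  finally show ?thesis .
qed

section \<open>Differentiation and substitution for primitives of positive densities\<close>

text \<open>A bad point of \<open>A\<close> lies in arbitrarily short intervals whose
  \<open>N\<close>-measure exceeds \<open>e\<close> times their length. Disjoint such intervals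
  inside an open set \<open>U\<close> have total length at most \<open>N\<close> of \<open>U\<close>
  divided by \<open>e\<close>, and outer regularity makes this small because \<open>A\<close> has no
  mass. The intervals only have to contain x, which suits difference quotients from either
  side.\<close>

lemma AE_vanishing_density_on_null_set:
  fixes N :: "real measure"
  assumes sets_N: "sets N = sets borel" and fin: "emeasure N UNIV \<noteq> \<infinity>"
    and A: "A \<in> sets borel" "emeasure N A = 0"
  shows "AE x in lborel. x \<in> A \<longrightarrow> (\<forall>e>0. \<exists>d>0. \<forall>a b. a \<le> x \<longrightarrow> x \<le> b \<longrightarrow> a < b \<longrightarrow> b - a < d \<longrightarrow>
           measure N {a..b} \<le> e * (b - a))"
proof -
  have space_N: "space N = UNIV"
    using sets_eq_imp_space_eq[OF sets_N] by simp
  interpret finite_measure N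
    by standard (use fin space_N in simp)
  define B where "B e = {x \<in> A. \<forall>d>0. \<exists>a b. a \<le> x \<and> x \<le> b \<and> a < b \<and> b - a < d \<and>
           measure N {a..b} > e * (b - a)}" for e
  text \<open>Cover \<open>B e\<close> by intervals inside an open set of small \<open>N\<close>-measure and apply Vitali.\<close>
  have negB: "negligible (B e)" if e: "e > 0" for e
    unfolding negligible_outer_le
  proof (intro allI impI)
    fix \<delta> :: real assume \<delta>: "0 < \<delta>"
    \<comment> \<open>The threshold \<open>\<delta> * e\<close> is chosen so that division by
      \<open>e\<close> leaves exactly \<open>\<delta>\<close>.\<close>
    have "(INF U \<in> {U. A \<subseteq> U \<and> open U}. emeasure N U) < ennreal (\<delta> * e)"
      using outer_regular[OF sets_N _ A(1)] fin A(2) space_N \<delta> e by simp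
    then obtain U where U: "A \<subseteq> U" "open U" "emeasure N U < ennreal (\<delta> * e)"
      by (auto simp: INF_less_iff)
    define K where "K = {(a, b). a < b \<and> {a..b} \<subseteq> U \<and> measure N {a..b} > e * (b - a)}"
    let ?c = "\<lambda>(a, b). (a + b) / 2 :: real" and ?r = "\<lambda>(a, b). (b - a) / 2 :: real"
    have cb: "cball (?c i) (?r i) = {fst i..snd i}" for i
      by (cases i) (auto simp: cball_eq_atLeastAtMost field_simps)
    obtain C where C: "countable C" "C \<subseteq> K"
      "pairwise (\<lambda>i j. disjnt (cball (?c i) (?r i)) (cball (?c j) (?r j))) C"
      "negligible (B e - (\<Union>i\<in>C. cball (?c i) (?r i)))"
    proof (rule Vitali_covering_theorem_cballs[of K ?r "B e" ?c])
      fix i assume "i \<in> K" then show "0 < ?r i" by (auto simp: K_def)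
    next
      fix x d :: real assume x: "x \<in> B e" and d: "0 < d"
      then have "x \<in> U" using U(1) by (auto simp: B_def)
      then obtain \<rho> where \<rho>: "\<rho> > 0" "ball x \<rho> \<subseteq> U"
        using U(2) open_contains_ball by blast
      obtain a b where ab: "a \<le> x" "x \<le> b" "a < b" "b - a < min d \<rho>" "measure N {a..b} > e * (b - a)"
        using x d \<rho>(1) unfolding B_def by (smt (verit) mem_Collect_eq)
      have "{a..b} \<subseteq> ball x \<rho>"
        using ab by (auto simp: dist_real_def)
      with \<rho>(2) ab have "(a, b) \<in> K"
        unfolding K_def by auto
      moreover have "x \<in> cball (?c (a, b)) (?r (a, b))"
        unfolding cb using ab by simp
      ultimately show "\<exists>i. i \<in> K \<and> x \<in> cball (?c i) (?r i) \<and> ?r i < d"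
        using ab by (intro exI[of _ "(a, b)"]) auto
    qed auto
    let ?I = "\<lambda>i::real \<times> real. {fst i..snd i}"
    have disj: "disjoint_family_on ?I C"
      using C(3) unfolding cb by (auto simp: disjoint_family_on_def pairwise_def disjnt_def)
    have "emeasure lborel (\<Union>i\<in>C. ?I i) = (\<integral>\<^sup>+i. emeasure lborel (?I i) \<partial>count_space C)"
      by (rule emeasure_UN_countable) (use C(1) disj in auto)
    also have "\<dots> \<le> (\<integral>\<^sup>+i. ennreal (1 / e) * emeasure N (?I i) \<partial>count_space C)"
    proof (rule nn_integral_mono)
      fix i assume "i \<in> space (count_space C)"
      with C(2) have "i \<in> K" by auto
      then have i: "fst i < snd i" "measure N (?I i) > e * (snd i - fst i)"
        by (auto simp: K_def)
      have "snd i - fst i \<le> 1 / e * measure N (?I i)"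
        using i e by (simp add: field_simps)
      then have "ennreal (snd i - fst i) \<le> ennreal (1 / e * measure N (?I i))"
        by (rule ennreal_leI)
      then show "emeasure lborel (?I i) \<le> ennreal (1 / e) * emeasure N (?I i)"
        using i e by (simp add: emeasure_eq_measure flip: ennreal_mult)
    qed
    also have "\<dots> = ennreal (1 / e) * emeasure N (\<Union>i\<in>C. ?I i)"
      by (subst emeasure_UN_countable)
        (use C(1) disj sets_N in \<open>auto simp: nn_integral_cmult\<close>)
    also have "\<dots> \<le> ennreal (1 / e) * emeasure N U"
    proof (intro mult_left_mono emeasure_mono)
      show "(\<Union>i\<in>C. ?I i) \<subseteq> U"
      proof (rule UN_least)
        fix i assume "i \<in> C"
        with C(2) have "i \<in> K" by auto
        then show "?I i \<subseteq> U" by (auto simp: K_def)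
      qed
    qed (use U(2) sets_N in auto)
    also have "\<dots> \<le> ennreal (1 / e) * ennreal (\<delta> * e)"
      using U(3) by (intro mult_left_mono) auto
    also have "\<dots> = ennreal \<delta>"
      using e \<delta> by (simp flip: ennreal_mult)
    finally have le: "emeasure lborel (\<Union>i\<in>C. ?I i) \<le> ennreal \<delta>" .
    let ?J = "\<Union>i\<in>C. ?I i"
    have J: "?J \<in> sets lborel"
      using C(1) by (intro sets.countable_UN'') auto
    have JL: "?J \<in> lmeasurable" 
      using J le by (intro fmeasurableI) (auto simp: top.not_eq_extremum intro: le_less_trans)
    have negl: "B e - ?J \<in> null_sets lebesgue"
      using C(4) unfolding cb negligible_iff_null_sets .
    show "\<exists>T. B e \<subseteq> T \<and> T \<in> lmeasurable \<and> measure lebesgue T \<le> \<delta>"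
    proof (intro exI conjI)
      show "B e \<subseteq> ?J \<union> (B e - ?J)" by auto
      show "?J \<union> (B e - ?J) \<in> lmeasurable"
        using JL negl by (intro fmeasurable.Un) (auto simp: negligible_iff_null_sets[symmetric] negligible_imp_measurable)
      have "measure lebesgue (?J \<union> (B e - ?J)) = measure lebesgue ?J"
        using JL negl by (intro measure_Un_null_set) auto
      also have "\<dots> \<le> \<delta>"
        using le J \<delta> by (simp add: measure_def enn2real_leI)
      finally show "measure lebesgue (?J \<union> (B e - ?J)) \<le> \<delta>" .
    qed
  qed
  \<comment> \<open>Countably many rates suffice, since the estimate for a smaller rate implies the
    one for a larger.\<close>
  have "AE x in lebesgue. \<forall>n. x \<notin> B (1 / real (Suc n))"
    unfolding AE_all_countable
  proof
    fix n
    have "B (1 / real (Suc n)) \<in> null_sets lebesgue"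
      using negB[of "1 / real (Suc n)"] by (simp add: negligible_iff_null_sets)
    then show "AE x in lebesgue. x \<notin> B (1 / real (Suc n))"
      by (rule AE_not_in)
  qed
  then have "AE x in lborel. \<forall>n. x \<notin> B (1 / real (Suc n))"
    by (simp add: AE_completion_iff)
  then show ?thesis
  proof eventually_elim
    case (elim x)
    show ?case
    proof (intro impI allI)
      fix e :: real assume xA: "x \<in> A" and "0 < e"
      then obtain n where n: "1 / real (Suc n) < e"
        using nat_approx_posE by blast
      have "x \<notin> B (1 / real (Suc n))" using elim by blast
      then obtain d where d: "d > 0" and *: "\<And>a b. a \<le> x \<Longrightarrow> x \<le> b \<Longrightarrow> a < b \<Longrightarrow> b - a < d \<Longrightarrow>
           measure N {a..b} \<le> 1 / real (Suc n) * (b - a)"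
        using xA unfolding B_def by (smt (verit) mem_Collect_eq)
      have "measure N {a..b} \<le> e * (b - a)" if "a \<le> x" "x \<le> b" "a < b" "b - a < d" for a b
        using *[OF that] mult_right_mono[of "1 / real (Suc n)" e "b - a"] n that by linarith
      then show "\<exists>d>0. \<forall>a b. a \<le> x \<longrightarrow> x \<le> b \<longrightarrow> a < b \<longrightarrow> b - a < d \<longrightarrow>
           measure N {a..b} \<le> e * (b - a)"
        using d by blast
    qed
  qed
qed

text \<open>The set integral makes this 0 for x \<le> 0. For positive densities with finite
  integrals it is therefore monotone on the whole line, which gives Borel measurability at
  once.\<close>

definition primitive :: "(real \<Rightarrow> real) \<Rightarrow> real \<Rightarrow> real" where
  "primitive k x = enn2real (\<integral>\<^sup>+t\<in>{0<..<x}. ennreal (k t) \<partial>lborel)"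

text \<open>There are two instances: a Borel version of w, with primitive W, and v^(1-p') w^p', with
  primitive \<sigma>. For the second, \<open>fin\<close> has to be deduced from the finiteness of
  A(s).\<close>

locale positive_density =
  fixes k :: "real \<Rightarrow> real"
  assumes borel [measurable]: "k \<in> borel_measurable borel"
    and pos: "\<And>x. 0 < x \<Longrightarrow> 0 < k x"
    and fin: "\<And>x. 0 < x \<Longrightarrow> (\<integral>\<^sup>+t\<in>{0<..<x}. ennreal (k t) \<partial>lborel) < \<infinity>"
begin

lemma primitive_nonpos [simp]: "x \<le> 0 \<Longrightarrow> primitive k x = 0"
  by (simp add: primitive_def)

lemma ennreal_primitive: "ennreal (primitive k x) = (\<integral>\<^sup>+t\<in>{0<..<x}. ennreal (k t) \<partial>lborel)"
  using fin[of x] by (cases "x > 0") (auto simp: primitive_def)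

lemma primitive_nonneg [simp]: "0 \<le> primitive k x"
  by (simp add: primitive_def)

lemma nn_integral_Icc:
  assumes "0 \<le> a" "a \<le> b"
  shows "(\<integral>\<^sup>+t\<in>{a..b}. ennreal (k t) \<partial>lborel) = ennreal (primitive k b - primitive k a)"
proof -
  have ae: "AE t in lborel. t \<noteq> a \<and> t \<noteq> b \<and> t \<noteq> 0"
    using AE_lborel_singleton[of a] AE_lborel_singleton[of b] AE_lborel_singleton[of 0] by auto
  have "(\<integral>\<^sup>+t\<in>{0<..<b}. ennreal (k t) \<partial>lborel)
      = (\<integral>\<^sup>+t. ennreal (k t) * indicator {0<..<a} t + ennreal (k t) * indicator {a..b} t \<partial>lborel)"
    using ae by (intro nn_integral_cong_AE, eventually_elim) (use assms in \<open>auto split: split_indicator\<close>)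
  also have "\<dots> = (\<integral>\<^sup>+t\<in>{0<..<a}. ennreal (k t) \<partial>lborel) + (\<integral>\<^sup>+t\<in>{a..b}. ennreal (k t) \<partial>lborel)"
    by (rule nn_integral_add) auto
  finally have *: "ennreal (primitive k b) = ennreal (primitive k a) + (\<integral>\<^sup>+t\<in>{a..b}. ennreal (k t) \<partial>lborel)"
    by (simp add: ennreal_primitive)
  have "ennreal (primitive k b) - ennreal (primitive k a) = (\<integral>\<^sup>+t\<in>{a..b}. ennreal (k t) \<partial>lborel)"
    unfolding * by (rule ennreal_add_diff_cancel_left) simp
  then show ?thesis by (simp add: ennreal_minus)
qed

lemma primitive_less:
  assumes "0 \<le> a" "a < b"
  shows "primitive k a < primitive k b"
proof (rule ccontr)
  assume "\<not> primitive k a < primitive k b"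
  then have "(\<integral>\<^sup>+t. ennreal (k t) * indicator {a..b} t \<partial>lborel) = 0"
    using nn_integral_Icc[of a b] assms by (simp add: ennreal_neg)
  then have "AE t in lborel. ennreal (k t) * indicator {a..b} t = 0"
    by (subst (asm) nn_integral_0_iff_AE) auto
  then have "AE t in lborel. t \<notin> {a<..b}"
  proof eventually_elim
    case (elim t)
    show ?case
    proof
      assume "t \<in> {a<..b}"
      with elim have "k t \<le> 0" by (auto simp: ennreal_eq_0_iff)
      with pos[of t] assms \<open>t \<in> {a<..b}\<close> show False by auto
    qed
  qed
  then have "{a<..b} \<in> null_sets lborel"
    by (subst AE_iff_null_sets) auto
  then show False
    using assms by (simp add: null_sets_def)
qed

lemma primitive_pos: "0 < x \<Longrightarrow> 0 < primitive k x"
  using primitive_less[of 0 x] by simp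

lemma primitive_mono: "a \<le> b \<Longrightarrow> primitive k a \<le> primitive k b"
  using primitive_less[of a b] by (cases "a \<ge> 0"; cases "a = b") auto

lemma mono_primitive: "mono (primitive k)"
  by (simp add: mono_def primitive_mono)

lemma borel_measurable_primitive [measurable]: "primitive k \<in> borel_measurable borel"
  by (rule borel_measurable_mono[OF mono_primitive])

lemma primitive_less_iff: "0 \<le> a \<Longrightarrow> 0 \<le> b \<Longrightarrow> primitive k a < primitive k b \<longleftrightarrow> a < b"
  using primitive_less primitive_mono by (metis not_le)

lemma primitive_inj: "0 \<le> a \<Longrightarrow> 0 \<le> b \<Longrightarrow> primitive k a = primitive k b \<longleftrightarrow> a = b"
  using primitive_less by (metis less_irrefl linorder_cases)

text \<open>Read as a gauge integral, the primitive is an indefinite integral and hence continuous.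
  This feeds the intermediate value theorem in \<open>primitive_surj\<close>.\<close>

lemma continuous_on_primitive: "continuous_on {0..X} (primitive k)"
proof -
  have "(k has_integral primitive k x - primitive k 0) {0..x}" if "0 \<le> x" for x
  proof -
    have "((\<lambda>t. k t * indicator {0<..x} t) has_integral primitive k x) UNIV"
    proof (rule nn_integral_has_integral)
      have "(\<integral>\<^sup>+t. ennreal (k t * indicator {0<..x} t) \<partial>lborel) = (\<integral>\<^sup>+t\<in>{0..x}. ennreal (k t) \<partial>lborel)"
        using AE_lborel_singleton[of 0]
        by (intro nn_integral_cong_AE) (auto elim!: eventually_mono split: split_indicator)
      also have "\<dots> = ennreal (primitive k x)"
        using nn_integral_Icc[of 0 x] that by simp
      finally show "(\<integral>\<^sup>+t. ennreal (k t * indicator {0<..x} t) \<partial>lborel) = ennreal (primitive k x)" .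
    qed (use pos in \<open>auto split: split_indicator intro: less_imp_le\<close>)
    then have "((\<lambda>t. if t \<in> {0<..x} then k t else 0) has_integral primitive k x) UNIV"
      by (rule has_integral_eq[rotated]) auto
    then have "(k has_integral primitive k x) {0<..x}"
      by (simp only: has_integral_restrict_UNIV)
    then have "(k has_integral primitive k x) {0..x}"
      by (subst (asm) has_integral_spike_set_eq[of _ "{0..x}"]) (auto intro: negligible_subset[of "{0}"])
    then show ?thesis by simp
  qed
  then have eq: "integral {0..x} k = primitive k x" "k integrable_on {0..x}" if "0 \<le> x" for x
    using that by (auto simp: integral_unique has_integral_integrable)
  show ?thesis
  proof (cases "0 \<le> X")
    case True
    have "continuous_on {0..X} (\<lambda>x. integral {0..x} k)"
      by (rule indefinite_integral_continuous_1[OF eq(2)[OF True]])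
    then show ?thesis
      by (subst (asm) continuous_on_cong[OF refl, of _ _ "primitive k"]) (auto simp: eq)
  qed auto
qed

lemma primitive_surj:
  assumes "0 \<le> y" "y \<le> primitive k X" "0 \<le> X"
  obtains x where "0 \<le> x" "x \<le> X" "primitive k x = y"
  using IVT'[of "primitive k" 0 y X] assms continuous_on_primitive[of X] by auto

lemma primitive_has_derivative_AE:
  "AE x in lborel. 0 < x \<longrightarrow> (primitive k has_real_derivative k x) (at x)"
proof -
  text \<open>Near a point with \<open>k x \<le> r\<close> the increments of the primitive exceed \<open>r * (b - a)\<close> by at most
    the \<open>N1\<close>-measure of \<open>[a, b]\<close>, which is \<open>o(b - a)\<close> because \<open>N1\<close> vanishes on \<open>{k \<le> r}\<close>;
    \<open>N2\<close> serves for the lower bound.\<close>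
  define N1 where "N1 n r = density lborel (\<lambda>x. ennreal (k x - r) * indicator {0<..<real n} x)" for n :: nat and r
  define N2 where "N2 n r = density lborel (\<lambda>x. ennreal (r - k x) * indicator {0<..<real n} x)" for n :: nat and r
  \<comment> \<open>\<open>ennreal\<close> cuts off negative values, so \<open>N1\<close> and
    \<open>N2\<close> have the densities (k - r)^+ and (r - k)^+. Truncation to (0,n) makes both
    measures finite.\<close>
  have k_fin: "(\<integral>\<^sup>+x\<in>{0<..<real n}. ennreal (k x) \<partial>lborel) < \<infinity>" for n
    using fin[of "real n"] by (cases "n = 0") auto
  have fin1: "emeasure (N1 n r) UNIV \<noteq> \<infinity>" if "0 \<le> r" for n r
  proof -
    have "emeasure (N1 n r) UNIV \<le> (\<integral>\<^sup>+x\<in>{0<..<real n}. ennreal (k x) \<partial>lborel)"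
      unfolding N1_def using that
      by (subst emeasure_density) (auto intro!: nn_integral_mono ennreal_leI split: split_indicator)
    then show ?thesis using k_fin[of n] by auto
  qed
  have fin2: "emeasure (N2 n r) UNIV \<noteq> \<infinity>" if "0 \<le> r" for n r
  proof -
    have "emeasure (N2 n r) UNIV \<le> (\<integral>\<^sup>+x\<in>{0<..<real n}. ennreal r \<partial>lborel)"
      unfolding N2_def using less_imp_le[OF pos]
      by (subst emeasure_density) (auto intro!: nn_integral_mono ennreal_leI split: split_indicator)
    also have "\<dots> < \<infinity>"
      by (simp add: nn_integral_cmult_indicator ennreal_mult_less_top)
    finally show ?thesis by auto
  qed
  define D where "D N x \<longleftrightarrow> (\<forall>e>0. \<exists>d>0. \<forall>a b. a \<le> x \<longrightarrow> x \<le> b \<longrightarrow> a < b \<longrightarrow> b - a < d \<longrightarrow>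
           measure N {a..b} \<le> e * (b - a))" for N :: "real measure" and x
  have ae1: "AE x in lborel. x \<in> {x. k x \<le> r} \<longrightarrow> D (N1 n r) x" if "0 \<le> r" for n r
    unfolding D_def
  proof (rule AE_vanishing_density_on_null_set)
    show "emeasure (N1 n r) {x. k x \<le> r} = 0"
      unfolding N1_def
      by (subst emeasure_density) (auto intro!: nn_integral_zero' AE_I2 simp: ennreal_neg split: split_indicator)
  qed (use fin1 that in \<open>auto simp: N1_def\<close>)
  have ae2: "AE x in lborel. x \<in> {x. r \<le> k x} \<longrightarrow> D (N2 n r) x" if "0 \<le> r" for n r
    unfolding D_def
  proof (rule AE_vanishing_density_on_null_set)
    show "emeasure (N2 n r) {x. r \<le> k x} = 0"
      unfolding N2_def
      by (subst emeasure_density) (auto intro!: nn_integral_zero' AE_I2 simp: ennreal_neg split: split_indicator)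
  qed (use fin2 that in \<open>auto simp: N2_def\<close>)
  have meas1: "ennreal (measure (N1 n r) {a..b}) = (\<integral>\<^sup>+x\<in>{a..b}. ennreal (k x - r) \<partial>lborel)"
    if "0 \<le> r" "0 < a" "b < real n" for n r a b
  proof -
    have "ennreal (measure (N1 n r) {a..b}) = emeasure (N1 n r) {a..b}"
      using fin1[OF that(1)] emeasure_mono[of "{a..b}" UNIV "N1 n r"]
      by (intro emeasure_eq_ennreal_measure[symmetric]) (auto simp: N1_def top_unique)
    also have "\<dots> = (\<integral>\<^sup>+x\<in>{a..b}. ennreal (k x - r) \<partial>lborel)"
      unfolding N1_def using that
      by (subst emeasure_density) (auto intro!: nn_integral_cong split: split_indicator)
    finally show ?thesis .
  qed
  have meas2: "ennreal (measure (N2 n r) {a..b}) = (\<integral>\<^sup>+x\<in>{a..b}. ennreal (r - k x) \<partial>lborel)"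
    if "0 \<le> r" "0 < a" "b < real n" for n r a b
  proof -
    have "ennreal (measure (N2 n r) {a..b}) = emeasure (N2 n r) {a..b}"
      using fin2[OF that(1)] emeasure_mono[of "{a..b}" UNIV "N2 n r"]
      by (intro emeasure_eq_ennreal_measure[symmetric]) (auto simp: N2_def top_unique)
    also have "\<dots> = (\<integral>\<^sup>+x\<in>{a..b}. ennreal (r - k x) \<partial>lborel)"
      unfolding N2_def using that
      by (subst emeasure_density) (auto intro!: nn_integral_cong split: split_indicator)
    finally show ?thesis .
  qed
  have up: "primitive k b - primitive k a \<le> r * (b - a) + measure (N1 n r) {a..b}"
    if "0 \<le> r" "0 < a" "a < b" "b < real n" for n r a b
  proof -
    have "ennreal (primitive k b - primitive k a) = (\<integral>\<^sup>+x\<in>{a..b}. ennreal (k x) \<partial>lborel)"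
      using nn_integral_Icc[of a b] that by simp
    also have "\<dots> \<le> (\<integral>\<^sup>+x. ennreal r * indicator {a..b} x + ennreal (k x - r) * indicator {a..b} x \<partial>lborel)"
    proof (intro nn_integral_mono)
      fix x
      have "ennreal (k x) \<le> ennreal r + ennreal (k x - r)"
        using that by (cases "k x \<ge> r") (auto simp: ennreal_neg simp flip: ennreal_plus intro!: ennreal_leI)
      then show "ennreal (k x) * indicator {a..b} x \<le> ennreal r * indicator {a..b} x + ennreal (k x - r) * indicator {a..b} x"
        by (auto split: split_indicator)
    qed
    also have "\<dots> = ennreal r * emeasure lborel {a..b} + ennreal (measure (N1 n r) {a..b})"
      using that by (subst nn_integral_add) (auto simp: meas1 nn_integral_cmult_indicator)
    also have "\<dots> = ennreal (r * (b - a) + measure (N1 n r) {a..b})"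
      using that by (simp add: ennreal_mult ennreal_plus)
    finally show ?thesis
      using that by (subst (asm) ennreal_le_iff) auto
  qed
  have lo: "r * (b - a) \<le> primitive k b - primitive k a + measure (N2 n r) {a..b}"
    if "0 \<le> r" "0 < a" "a < b" "b < real n" for n r a b
  proof -
    have "ennreal (r * (b - a)) = (\<integral>\<^sup>+x\<in>{a..b}. ennreal r \<partial>lborel)"
      using that by (simp add: nn_integral_cmult_indicator ennreal_mult)
    also have "\<dots> \<le> (\<integral>\<^sup>+x. ennreal (k x) * indicator {a..b} x + ennreal (r - k x) * indicator {a..b} x \<partial>lborel)"
    proof (intro nn_integral_mono)
      fix x
      show "ennreal r * indicator {a..b} x \<le> ennreal (k x) * indicator {a..b} x + ennreal (r - k x) * indicator {a..b} x"
      proof (cases "x \<in> {a..b}")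
        case True
        then have "0 \<le> k x" using pos[of x] that by auto
        then have "ennreal r \<le> ennreal (k x) + ennreal (r - k x)"
          using that by (cases "k x \<le> r") (auto simp: ennreal_neg simp flip: ennreal_plus intro!: ennreal_leI)
        with True show ?thesis by simp
      qed auto
    qed
    also have "\<dots> = ennreal (primitive k b - primitive k a) + ennreal (measure (N2 n r) {a..b})"
      using that by (subst nn_integral_add) (auto simp: meas2 nn_integral_Icc)
    also have "\<dots> = ennreal (primitive k b - primitive k a + measure (N2 n r) {a..b})"
      using that by (intro ennreal_plus[symmetric]) (auto intro: primitive_mono)
    finally show ?thesis
      using that primitive_mono[of a b] by (subst (asm) ennreal_le_iff) (auto intro!: add_nonneg_nonneg)
  qed
  \<comment> \<open>Rational levels keep the exceptional set a countable union of null sets and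
    still approximate \<open>k x\<close> from both sides.\<close>
  have "AE x in lborel. \<forall>n. \<forall>r\<in>{r\<in>\<rat>. 0 \<le> r}. (k x \<le> r \<longrightarrow> D (N1 n r) x) \<and> (r \<le> k x \<longrightarrow> D (N2 n r) x)"
    unfolding AE_all_countable
  proof
    fix n
    have "countable {r\<in>\<rat>. (0::real) \<le> r}"
      by (rule countable_subset[OF _ countable_rat]) auto
    then show "AE x in lborel. \<forall>r\<in>{r\<in>\<rat>. 0 \<le> r}. (k x \<le> r \<longrightarrow> D (N1 n r) x) \<and> (r \<le> k x \<longrightarrow> D (N2 n r) x)"
      using ae1 ae2 by (subst AE_ball_countable) auto
  qed
  then show ?thesis
  proof eventually_elim
    case (elim x)
    show ?case
    proof
      assume x: "0 < x"
      obtain n where n: "x < real n" using reals_Archimedean2 by blast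
      have "\<exists>d>0. \<forall>a b. a \<le> x \<longrightarrow> x \<le> b \<longrightarrow> a < b \<longrightarrow> b - a < d \<longrightarrow>
          \<bar>primitive k b - primitive k a - k x * (b - a)\<bar> \<le> e * (b - a)" if e: "e > 0" for e
      proof -
        obtain r1 where r1: "r1 \<in> \<rat>" "k x < r1" "r1 < k x + e / 2"
          using Rats_dense_in_real[of "k x" "k x + e / 2"] e by auto
        \<comment> \<open>The maximum with 0 keeps the level in the range covered by
          \<open>ae2\<close> and \<open>lo\<close>; the gap below \<open>k x\<close> is nonempty
          because \<open>k x\<close> is positive.\<close>
        obtain r2 where r2: "r2 \<in> \<rat>" "max 0 (k x - e / 2) < r2" "r2 < k x"
          using Rats_dense_in_real[of "max 0 (k x - e / 2)" "k x"] e pos[OF x] by auto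
        have "D (N1 n r1) x" "D (N2 n r2) x"
          using elim r1 r2 pos[OF x] by auto
        then obtain d1 d2 where d: "d1 > 0" "d2 > 0"
          "\<And>a b. a \<le> x \<Longrightarrow> x \<le> b \<Longrightarrow> a < b \<Longrightarrow> b - a < d1 \<Longrightarrow> measure (N1 n r1) {a..b} \<le> e / 2 * (b - a)"
          "\<And>a b. a \<le> x \<Longrightarrow> x \<le> b \<Longrightarrow> a < b \<Longrightarrow> b - a < d2 \<Longrightarrow> measure (N2 n r2) {a..b} \<le> e / 2 * (b - a)"
          using half_gt_zero[OF e] unfolding D_def by metis
        \<comment> \<open>The bounds x and n - x keep [a,b] inside (0,n), where the truncation has
          no effect.\<close>
        define d0 where "d0 = min (min d1 d2) (min x (real n - x))"
        have "\<bar>primitive k b - primitive k a - k x * (b - a)\<bar> \<le> e * (b - a)"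
          if "a \<le> x" "x \<le> b" "a < b" "b - a < d0" for a b
        proof -
          have ab: "0 < a" "b < real n" "b - a < d1" "b - a < d2"
            using that by (auto simp: d0_def)
          have "primitive k b - primitive k a \<le> r1 * (b - a) + e / 2 * (b - a)"
            using up[of r1 a b n] d(3)[of a b] ab that r1 pos[OF x] by linarith
          also have "\<dots> \<le> (k x + e / 2) * (b - a) + e / 2 * (b - a)"
            using r1 that by (intro add_mono mult_right_mono) auto
          finally have 1: "primitive k b - primitive k a \<le> k x * (b - a) + e * (b - a)"
            by (simp add: algebra_simps)
          have "(k x - e / 2) * (b - a) \<le> r2 * (b - a)"
            using r2 that by (intro mult_right_mono) auto
          also have "\<dots> \<le> primitive k b - primitive k a + e / 2 * (b - a)"
            using lo[of r2 a b n] d(4)[of a b] ab that r2 pos[OF x] by linarith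
          finally have 2: "k x * (b - a) - e * (b - a) \<le> primitive k b - primitive k a"
            by (simp add: algebra_simps)
          from 1 2 show ?thesis by linarith
        qed
        moreover have "d0 > 0" using d x n by (simp add: d0_def)
        ultimately show ?thesis by blast
      qed
      note * = this
      show "(primitive k has_real_derivative k x) (at x)"
        unfolding has_field_derivative_def has_derivative_at_alt
      proof (intro conjI allI impI bounded_linear_mult_right)
        fix e :: real assume "0 < e"
        from *[OF this] obtain d where d: "d > 0" "\<And>a b. a \<le> x \<Longrightarrow> x \<le> b \<Longrightarrow> a < b \<Longrightarrow> b - a < d \<Longrightarrow>
          \<bar>primitive k b - primitive k a - k x * (b - a)\<bar> \<le> e * (b - a)" by blast
        have "\<bar>primitive k y - primitive k x - k x * (y - x)\<bar> \<le> e * \<bar>y - x\<bar>" if "\<bar>y - x\<bar> < d" for y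
        proof (cases x y rule: linorder_cases)
          case less
          then show ?thesis using d(2)[of x y] that by simp
        next
          case greater
          then have "\<bar>primitive k x - primitive k y - k x * (x - y)\<bar> \<le> e * (x - y)"
            using d(2)[of y x] that by simp
          moreover have "primitive k y - primitive k x - k x * (y - x) = - (primitive k x - primitive k y - k x * (x - y))"
            by (simp add: algebra_simps)
          ultimately show ?thesis using greater by simp
        qed auto
        with d(1) show "\<exists>d>0. \<forall>y. norm (y - x) < d \<longrightarrow>
            norm (primitive k y - primitive k x - k x * (y - x)) \<le> e * norm (y - x)"
          by auto
      qed
    qed
  qed
qed

text \<open>The primitive pushes the measure k dx on (0,X) forward to Lebesgue measure on (0,
  \<open>primitive k X\<close>). Both are finite, so comparing them on the rays (c,\<infinity>) is
  enough, and there the preimage is an interval by the intermediate value theorem. The argument does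
  not differentiate the primitive.\<close>

lemma nn_integral_substitution_primitive:
  assumes [measurable]: "h \<in> borel_measurable borel" and X: "0 < X"
  shows "(\<integral>\<^sup>+x\<in>{0<..<X}. h (primitive k x) * ennreal (k x) \<partial>lborel)
       = (\<integral>\<^sup>+y\<in>{0<..<primitive k X}. h y \<partial>lborel)"
proof -
  let ?N1 = "distr (density lborel (\<lambda>x. ennreal (k x) * indicator {0<..<X} x)) borel (primitive k)"
  let ?N2 = "density lborel (indicator {0<..<primitive k X}) :: real measure"
  have e1: "emeasure ?N1 {c<..} = (\<integral>\<^sup>+x. ennreal (k x) * indicator {x. 0 < x \<and> x < X \<and> c < primitive k x} x \<partial>lborel)" for c
    using measurable_sets_borel[OF borel_measurable_primitive, of "{c<..}"]
    by (subst emeasure_distr, simp, simp, subst emeasure_density)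
      (auto intro!: nn_integral_cong split: split_indicator)
  have e2: "emeasure ?N2 {c<..} = emeasure lborel ({0<..<primitive k X} \<inter> {c<..})" for c
    by (subst emeasure_density) (auto simp flip: nn_integral_indicator intro!: nn_integral_cong split: split_indicator)
  have total: "(\<integral>\<^sup>+x\<in>{0<..<X}. ennreal (k x) \<partial>lborel) = ennreal (primitive k X)"
    by (simp add: ennreal_primitive)
  have "?N1 = ?N2"
  proof (rule measure_eqI_lessThan)
    fix c
    show "emeasure ?N1 {c<..} < \<infinity>"
    proof -
      have "emeasure ?N1 {c<..} \<le> (\<integral>\<^sup>+x\<in>{0<..<X}. ennreal (k x) \<partial>lborel)"
        unfolding e1 by (auto intro!: nn_integral_mono split: split_indicator)
      then show ?thesis using fin[OF X] by auto
    qed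
    consider "c < 0" | "primitive k X \<le> c" | "0 \<le> c" "c < primitive k X" by linarith
    then show "emeasure ?N1 {c<..} = emeasure ?N2 {c<..}"
    proof cases
      case 1
      then have "{0<..<primitive k X} \<inter> {c<..} = {0<..<primitive k X}" by auto
      moreover have "{x. 0 < x \<and> x < X \<and> c < primitive k x} = {0<..<X}"
        using 1 by (auto intro: less_le_trans)
      ultimately show ?thesis using e1 e2 total by simp
    next
      case 2
      then have "{0<..<primitive k X} \<inter> {c<..} = {}" by auto
      moreover have "{x. 0 < x \<and> x < X \<and> c < primitive k x} = {}"
        using 2 primitive_mono[of _ X] by (smt (verit) Collect_empty_eq)
      ultimately show ?thesis using e1 e2 by simp
    next
      case 3
      obtain t where t: "0 \<le> t" "t \<le> X" "primitive k t = c"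
        using primitive_surj[of c X] 3 X by auto
      have "{x. 0 < x \<and> x < X \<and> c < primitive k x} = {t<..<X}"
        using t by (auto simp: primitive_less_iff simp flip: t(3))
      then have "emeasure ?N1 {c<..} = (\<integral>\<^sup>+x\<in>{t<..<X}. ennreal (k x) \<partial>lborel)"
        using e1 by simp
      also have "\<dots> = (\<integral>\<^sup>+x\<in>{t..X}. ennreal (k x) \<partial>lborel)"
        using AE_lborel_singleton[of t] AE_lborel_singleton[of X]
        by (intro nn_integral_cong_AE, eventually_elim) (auto split: split_indicator)
      also have "\<dots> = ennreal (primitive k X - c)"
        using nn_integral_Icc[of t X] t by simp
      also have "\<dots> = emeasure lborel ({0<..<primitive k X} \<inter> {c<..})"
      proof -
        have "{0<..<primitive k X} \<inter> {c<..} = {c<..<primitive k X}" using 3 by auto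
        then show ?thesis using 3 by simp
      qed
      finally show ?thesis using e2 by simp
    qed
  qed auto
  then have "(\<integral>\<^sup>+y. h y \<partial>?N1) = (\<integral>\<^sup>+y. h y \<partial>?N2)" by simp
  then show ?thesis
    by (simp add: nn_integral_distr nn_integral_density mult_ac)
qed

end

text \<open>Meant for W, the only primitive that is inverted; \<sigma> may well be bounded.\<close>

locale unbounded_density = positive_density +
  assumes unbounded: "\<And>y. \<exists>x>0. y < primitive k x"
begin

text \<open>On the positive half-line this is \<open>cumul_inv\<close>. The value 0 elsewhere
  extends it monotonically to the whole line, so it is Borel.\<close>

definition inv_primitive :: "real \<Rightarrow> real" where
  "inv_primitive y = (if 0 < y then the_inv_into {0<..} (primitive k) y else 0)"

lemma inj_on_primitive: "inj_on (primitive k) {0<..}"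
  by (auto simp: inj_on_def primitive_inj)

lemma inv_primitive_primitive [simp]: "0 < x \<Longrightarrow> inv_primitive (primitive k x) = x"
  by (simp add: inv_primitive_def primitive_pos the_inv_into_f_f[OF inj_on_primitive])

lemma primitive_surj_pos:
  assumes "0 < y"
  obtains x where "0 < x" "primitive k x = y"
proof -
  obtain X where "0 < X" "y < primitive k X" using unbounded by blast
  then obtain x where "0 \<le> x" "primitive k x = y"
    using primitive_surj[of y X] assms by auto
  with assms show thesis by (intro that[of x]) (auto simp: less_le)
qed

lemma inv_primitive_pos: "0 < y \<Longrightarrow> 0 < inv_primitive y"
  using primitive_surj_pos[of y] by (metis inv_primitive_primitive)

lemma primitive_inv_primitive [simp]: "0 < y \<Longrightarrow> primitive k (inv_primitive y) = y"
  using primitive_surj_pos[of y] by (metis inv_primitive_primitive)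

lemma inv_primitive_less_iff: "0 < x \<Longrightarrow> 0 < y \<Longrightarrow> inv_primitive y < x \<longleftrightarrow> y < primitive k x"
  using primitive_less_iff[of "inv_primitive y" x] inv_primitive_pos[of y] by simp

lemma less_inv_primitive_iff: "0 < x \<Longrightarrow> 0 < y \<Longrightarrow> x < inv_primitive y \<longleftrightarrow> primitive k x < y"
  using primitive_less_iff[of x "inv_primitive y"] inv_primitive_pos[of y] by simp

lemma borel_measurable_inv_primitive [measurable]: "inv_primitive \<in> borel_measurable borel"
proof (rule borel_measurable_mono)
  show "mono inv_primitive"
  proof (rule monoI)
    fix x y :: real assume "x \<le> y"
    show "inv_primitive x \<le> inv_primitive y"
    proof (cases "0 < x")
      case True
      then show ?thesis
        using \<open>x \<le> y\<close> primitive_less_iff[of "inv_primitive y" "inv_primitive x"]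
          inv_primitive_pos[of x] inv_primitive_pos[of y] by (auto simp: not_less[symmetric])
    next
      case False
      then show ?thesis
        using inv_primitive_pos[of y] by (cases "0 < y") (auto simp: inv_primitive_def[of x] inv_primitive_def[of y])
    qed
  qed
qed

lemma nn_integral_inv_primitive:
  assumes [measurable]: "h \<in> borel_measurable borel"
  shows "(\<integral>\<^sup>+y\<in>{0<..}. h (inv_primitive y) \<partial>lborel) = (\<integral>\<^sup>+x\<in>{0<..}. h x * ennreal (k x) \<partial>lborel)"
proof -
  \<comment> \<open>The cut-offs start at 1 because the substitution rule asks for a positive right
    endpoint.\<close>
  have cut: "(\<integral>\<^sup>+y. (h (inv_primitive y)) * indicator {0<..<primitive k (real (Suc n))} y \<partial>lborel)
      = (\<integral>\<^sup>+x. (h x * ennreal (k x)) * indicator {0<..<real (Suc n)} x \<partial>lborel)" for n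
    using nn_integral_substitution_primitive[of "\<lambda>y. h (inv_primitive y)" "real (Suc n)"]
    by (auto simp del: of_nat_Suc intro!: nn_integral_cong split: split_indicator elim!: trans[OF sym])
  have "\<exists>n. y < primitive k (real (Suc n))" for y
  proof -
    obtain x where "y < primitive k x" using unbounded by blast
    moreover obtain n where "x < real n" using reals_Archimedean2 by blast
    ultimately show ?thesis
      using primitive_mono[of x "real (Suc n)"] by (intro exI[of _ n]) auto
  qed
  moreover have "\<exists>n. y < real (Suc n)" for y
    using reals_Archimedean2[of y] by (metis less_trans of_nat_less_iff lessI)
  ultimately show ?thesis
    by (subst (1 2) nn_integral_Ioi_SUP[where c="\<lambda>n. primitive k (real (Suc n))"] nn_integral_Ioi_SUP[where c="\<lambda>n. real (Suc n)"])
      (auto simp: mono_def intro!: primitive_mono SUP_cong cut simp del: of_nat_Suc)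
qed

text \<open>The image of a null set N under the primitive has measure equal to the integral of k
  over N, which is 0. This carries W' = w and the Borel versions of the weights over to the variable
  y = W(x).\<close>

lemma AE_inv_primitive:
  assumes "AE x in lborel. 0 < x \<longrightarrow> P x"
  shows "AE y in lborel. 0 < y \<longrightarrow> P (inv_primitive y)"
proof -
  obtain N where N: "\<And>x. x \<notin> N \<Longrightarrow> 0 < x \<Longrightarrow> P x" "N \<in> null_sets lborel"
    using AE_E3[OF assms] by auto
  then have [measurable]: "N \<in> sets borel" by auto
  have "(\<integral>\<^sup>+y\<in>{0<..}. indicator N (inv_primitive y) \<partial>lborel) = (\<integral>\<^sup>+x\<in>{0<..}. indicator N x * ennreal (k x) \<partial>lborel)"
    by (rule nn_integral_inv_primitive) simp
  also have "\<dots> = 0"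
    using AE_not_in[OF N(2)] by (subst nn_integral_0_iff_AE) (auto elim: eventually_mono)
  finally have "AE y in lborel. indicator N (inv_primitive y) * indicator {0<..} y = (0::ennreal)"
    by (subst (asm) nn_integral_0_iff_AE) auto
  then show ?thesis
    by eventually_elim (use N(1) inv_primitive_pos in \<open>auto split: split_indicator_asm\<close>)
qed

end

section \<open>The weighted Hardy inequality\<close>

lemma epowr_ennreal: "0 \<le> x \<Longrightarrow> epowr (ennreal x) r = ennreal (x powr r)"
  by (simp add: epowr_def)

lemma epowr_top [simp]: "epowr \<top> r = \<top>"
  by (simp add: epowr_def)

lemma epowr_0 [simp]: "epowr 0 r = 0"
  by (simp add: epowr_def)

lemma epowr_mono:
  assumes "0 \<le> r" "x \<le> y"
  shows "epowr x r \<le> epowr y r"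
  using assms by (cases x; cases y) (auto simp: epowr_ennreal powr_mono2 top_unique intro!: ennreal_leI)

lemma epowr_mult:
  assumes "0 < r"
  shows "epowr (x * y) r = epowr x r * epowr y r"
proof (cases "x = \<top> \<or> y = \<top>")
  case True
  then show ?thesis
    by (cases x; cases y) (auto simp: epowr_ennreal ennreal_mult_top ennreal_top_mult ennreal_mult_eq_top_iff)
next
  case False
  then show ?thesis
    by (cases x; cases y) (auto simp: epowr_ennreal powr_mult simp flip: ennreal_mult)
qed

lemma epowr_epowr: "epowr (epowr x a) b = epowr x (a * b)"
  by (cases x) (auto simp: epowr_ennreal powr_powr)

lemma epowr_1 [simp]: "epowr x 1 = x"
  by (cases x) (auto simp: epowr_ennreal)

lemma borel_measurable_epowr [measurable]:
  assumes [measurable]: "f \<in> borel_measurable M"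
  shows "(\<lambda>x. epowr (f x) r) \<in> borel_measurable M"
  unfolding epowr_def by measurable

section \<open>Hoelder's and Minkowski's inequalities\<close>

text \<open>The graph of the convex function y^r lies above its tangent at c; this is Young's
  inequality with weights 1/r and 1 - 1/r. The left side is linear in y, so the inequality can be
  integrated before c is chosen.\<close>

lemma powr_tangent_le:
  fixes c y r :: real
  assumes "1 \<le> r" "0 < c" "0 \<le> y"
  shows "r * c powr (r - 1) * y \<le> y powr r + (r - 1) * c powr r"
proof (cases "y = 0")
  case True
  then show ?thesis using assms by simp
next
  case False
  have "(y powr r) powr (1 / r) * (c powr r) powr (1 - 1 / r) \<le> 1 / r * (y powr r) + (1 - 1 / r) * (c powr r)"
    using assms False by (intro Youngs_inequality_0) auto
  moreover have "(y powr r) powr (1 / r) = y" "(c powr r) powr (1 - 1 / r) = c powr (r - 1)"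
    using assms by (auto simp: powr_powr right_diff_distrib)
  ultimately have "r * (y * c powr (r - 1)) \<le> r * (1 / r * (y powr r) + (1 - 1 / r) * (c powr r))"
    using assms by (intro mult_left_mono) auto
  also have "\<dots> = y powr r + (r - 1) * c powr r"
    using assms by (simp add: field_simps)
  finally show ?thesis by (simp add: mult_ac)
qed

text \<open>Hoelder's inequality in Jensen form. Since \<open>0 powr 0 = 0\<close>, the case \<open>r = 1\<close> on a null space reads
  \<open>0 \<le> 0\<close>.\<close>

lemma power_mean_inequality:
  assumes r: "1 \<le> r" and [measurable]: "\<psi> \<in> borel_measurable M"
    and fin: "emeasure M (space M) < \<infinity>"
  shows "epowr (\<integral>\<^sup>+x. \<psi> x \<partial>M) r \<le> (\<integral>\<^sup>+x. epowr (\<psi> x) r \<partial>M) * epowr (emeasure M (space M)) (r - 1)"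
proof -
  obtain T where T: "emeasure M (space M) = ennreal T" "0 \<le> T"
    using fin by (cases "emeasure M (space M)") auto
  show ?thesis
  proof (cases "T = 0")
    case True
    then have "space M \<in> null_sets M"
      using T by (auto simp: null_sets_def)
    have "(\<integral>\<^sup>+x. \<psi> x \<partial>M) = (\<integral>\<^sup>+x\<in>space M. \<psi> x \<partial>M)"
      by (rule nn_integral_cong) simp
    also have "\<dots> = 0"
      by (rule nn_integral_null_set) fact
    finally have "(\<integral>\<^sup>+x. \<psi> x \<partial>M) = 0" .
    then show ?thesis by simp
  next
    case False
    with T have "T > 0" by simp
    have tangent: "ennreal (r * c powr (r - 1)) * (\<integral>\<^sup>+x. \<psi> x \<partial>M)
        \<le> (\<integral>\<^sup>+x. epowr (\<psi> x) r \<partial>M) + ennreal ((r - 1) * c powr r * T)" if "0 < c" for c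
    proof -
      have "ennreal (r * c powr (r - 1)) * (\<integral>\<^sup>+x. \<psi> x \<partial>M) = (\<integral>\<^sup>+x. ennreal (r * c powr (r - 1)) * \<psi> x \<partial>M)"
        by (rule nn_integral_cmult[symmetric]) simp
      also have "\<dots> \<le> (\<integral>\<^sup>+x. epowr (\<psi> x) r + ennreal ((r - 1) * c powr r) \<partial>M)"
      proof (rule nn_integral_mono)
        fix x
        show "ennreal (r * c powr (r - 1)) * \<psi> x \<le> epowr (\<psi> x) r + ennreal ((r - 1) * c powr r)"
          using powr_tangent_le[OF r that] r
          by (cases "\<psi> x") (auto simp: epowr_ennreal simp flip: ennreal_mult ennreal_plus intro!: ennreal_leI)
      qed
      also have "\<dots> = (\<integral>\<^sup>+x. epowr (\<psi> x) r \<partial>M) + ennreal ((r - 1) * c powr r) * ennreal T"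
        by (subst nn_integral_add) (auto simp: T)
      finally show ?thesis
        using r T by (simp add: ennreal_mult)
    qed
    show ?thesis
    proof (cases "\<integral>\<^sup>+x. epowr (\<psi> x) r \<partial>M")
      case top
      then show ?thesis using T \<open>T > 0\<close> by (simp add: epowr_ennreal ennreal_top_mult)
    next
      case (real P)
      \<comment> \<open>The tangent at 1 already bounds the integral of \<open>\<psi>\<close>;
        finiteness is needed before the mean value \<open>I / T\<close> can serve as the tangent
        point.\<close>
      have "(\<integral>\<^sup>+x. \<psi> x \<partial>M) \<noteq> \<top>"
        using tangent[of 1] real r by (auto simp: ennreal_mult_top top_unique)
      then obtain I where I: "(\<integral>\<^sup>+x. \<psi> x \<partial>M) = ennreal I" "0 \<le> I"
        by (cases "\<integral>\<^sup>+x. \<psi> x \<partial>M") auto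
      show ?thesis
      proof (cases "I = 0")
        case False
        with I have "I > 0" by simp
        define c where "c = I / T" \<comment> \<open>optimal tangent point\<close>
        have c: "c > 0" using \<open>I > 0\<close> \<open>T > 0\<close> by (simp add: c_def)
        have "ennreal (r * c powr (r - 1) * I) \<le> ennreal (P + (r - 1) * c powr r * T)"
          using tangent[OF c] real I r T by (simp add: ennreal_mult)
        then have "r * c powr (r - 1) * I \<le> P + (r - 1) * c powr r * T"
          using real r T by (subst (asm) ennreal_le_iff) auto
        moreover have cI: "c powr (r - 1) * I = c powr r * T"
          using c \<open>T > 0\<close> by (simp add: c_def powr_diff field_simps)
        moreover have "r * c powr (r - 1) * I = r * (c powr r * T)"
          unfolding mult.assoc cI ..
        moreover have "(r - 1) * c powr r * T = r * (c powr r * T) - c powr r * T"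
          by (simp add: algebra_simps)
        ultimately have "c powr r * T \<le> P"
          by linarith
        then have "c powr r * T * T powr (r - 1) \<le> P * T powr (r - 1)"
          by (intro mult_right_mono) auto
        moreover have "c powr r * T * T powr (r - 1) = I powr r"
          using \<open>I > 0\<close> \<open>T > 0\<close> by (simp add: c_def powr_divide powr_diff)
        ultimately show ?thesis
          using I T real by (simp add: epowr_ennreal ennreal_leI flip: ennreal_mult)
      qed (simp add: I)
    qed
  qed
qed

text \<open>Minkowski's inequality for the kernel \<open>1\<^bsub>t < x\<^esub>\<close>: the power mean inequality for the density
  \<open>\<phi> g\<^bsup>1/r\<^esup>\<close> applied to \<open>g\<^bsup>-1/r\<^esup>\<close>, followed by Tonelli.\<close>

lemma minkowski_integral_triangle:
  fixes H \<phi> :: "real \<Rightarrow> ennreal"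
  assumes r: "1 \<le> r" and [measurable]: "H \<in> borel_measurable borel" "\<phi> \<in> borel_measurable borel"
    and G: "\<And>t. 0 < t \<Longrightarrow> (\<integral>\<^sup>+x\<in>{t<..}. H x \<partial>lborel) = ennreal (g t)"
    and g: "\<And>t. 0 < t \<Longrightarrow> 0 < g t" and [measurable]: "g \<in> borel_measurable borel"
    and fin: "(\<integral>\<^sup>+t\<in>{0<..}. \<phi> t * ennreal (g t powr (1 / r)) \<partial>lborel) < \<infinity>"
  shows "(\<integral>\<^sup>+x\<in>{0<..}. H x * epowr (\<integral>\<^sup>+t\<in>{0<..<x}. \<phi> t \<partial>lborel) r \<partial>lborel)
    \<le> epowr (\<integral>\<^sup>+t\<in>{0<..}. \<phi> t * ennreal (g t powr (1 / r)) \<partial>lborel) r"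
proof -
  define D where "D = (\<integral>\<^sup>+t\<in>{0<..}. \<phi> t * ennreal (g t powr (1 / r)) \<partial>lborel)"
  define m where "m t = \<phi> t * ennreal (g t powr (1 / r)) * indicator {0<..} t" for t
  have [measurable]: "m \<in> borel_measurable borel" unfolding m_def by measurable
  have totalD: "emeasure (density lborel m) UNIV = D"
    unfolding D_def m_def by (simp add: emeasure_density)
  \<comment> \<open>This is the integral of \<open>\<psi>\<close> to the power r against
    \<open>m\<close>. After Tonelli the factor g^(1/r - 1) meets the tail integral g of
    \<open>H\<close>, and their product g^(1/r) restores the density \<open>m\<close> of total mass
    \<open>D\<close>.\<close>
  define Q where "Q x = (\<integral>\<^sup>+t. \<phi> t * ennreal (g t powr (1 / r - 1)) * (if 0 < t \<and> t < x then 1 else 0) \<partial>lborel)" for x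
  have [measurable]: "Q \<in> borel_measurable borel" unfolding Q_def by measurable
  have pt: "epowr (\<integral>\<^sup>+t\<in>{0<..<x}. \<phi> t \<partial>lborel) r \<le> Q x * epowr D (r - 1)" for x
  proof -
    define \<psi> where "\<psi> t = ennreal (g t powr (- 1 / r)) * indicator {0<..<x} t" for t
    have [measurable]: "\<psi> \<in> borel_measurable borel" unfolding \<psi>_def by measurable
    have "epowr (\<integral>\<^sup>+t. \<psi> t \<partial>density lborel m) r
      \<le> (\<integral>\<^sup>+t. epowr (\<psi> t) r \<partial>density lborel m) * epowr (emeasure (density lborel m) (space (density lborel m))) (r - 1)"
      by (rule power_mean_inequality[OF r]) (use fin totalD D_def in auto)
    moreover have "(\<integral>\<^sup>+t. \<psi> t \<partial>density lborel m) = (\<integral>\<^sup>+t\<in>{0<..<x}. \<phi> t \<partial>lborel)"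
    proof -
      have "m t * \<psi> t = \<phi> t * indicator {0<..<x} t" for t
      proof -
        have "ennreal (g t powr (1 / r)) * ennreal (g t powr (- 1 / r)) = 1" if "0 < t"
          using g[OF that] r by (simp flip: ennreal_mult powr_add)
        then show ?thesis
          by (auto simp: m_def \<psi>_def mult.assoc split: split_indicator)
      qed
      then show ?thesis by (simp add: nn_integral_density)
    qed
    moreover have "(\<integral>\<^sup>+t. epowr (\<psi> t) r \<partial>density lborel m) = Q x"
    proof -
      have "m t * epowr (\<psi> t) r = \<phi> t * ennreal (g t powr (1 / r - 1)) * (if 0 < t \<and> t < x then 1 else 0)" for t
      proof -
        have "ennreal (g t powr (1 / r)) * epowr (ennreal (g t powr (- 1 / r))) r = ennreal (g t powr (1 / r - 1))" if "0 < t"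
        proof -
          have "(g t powr (- 1 / r)) powr r = g t powr (- 1)"
            using r by (simp only: powr_powr) simp
          then show ?thesis
            using r g[OF that] by (simp add: epowr_ennreal powr_diff flip: ennreal_mult)
        qed
        then show ?thesis
          by (auto simp: m_def \<psi>_def mult.assoc split: split_indicator)
      qed
      then show ?thesis by (simp add: nn_integral_density Q_def)
    qed
    ultimately show ?thesis using totalD by simp
  qed
  have "(\<integral>\<^sup>+x\<in>{0<..}. H x * epowr (\<integral>\<^sup>+t\<in>{0<..<x}. \<phi> t \<partial>lborel) r \<partial>lborel)
      \<le> (\<integral>\<^sup>+x. (H x * Q x) * epowr D (r - 1) \<partial>lborel)"
    using mult_left_mono[OF pt]
    by (intro nn_integral_mono) (auto simp: mult.assoc split: split_indicator)
  also have "\<dots> = (\<integral>\<^sup>+x. H x * Q x \<partial>lborel) * epowr D (r - 1)"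
    by (rule nn_integral_multc) simp
  also have "(\<integral>\<^sup>+x. H x * Q x \<partial>lborel)
      = (\<integral>\<^sup>+x. \<integral>\<^sup>+t. H x * (\<phi> t * ennreal (g t powr (1 / r - 1)) * (if 0 < t \<and> t < x then 1 else 0)) \<partial>lborel \<partial>lborel)"
    unfolding Q_def by (intro nn_integral_cong nn_integral_cmult[symmetric]) measurable
  also have "\<dots> = (\<integral>\<^sup>+t. \<integral>\<^sup>+x. H x * (\<phi> t * ennreal (g t powr (1 / r - 1)) * (if 0 < t \<and> t < x then 1 else 0)) \<partial>lborel \<partial>lborel)"
    by (rule lborel_pair.Fubini') measurable
  also have "\<dots> = (\<integral>\<^sup>+t. m t \<partial>lborel)"
  proof (rule nn_integral_cong)
    fix t
    have "(\<integral>\<^sup>+x. H x * (\<phi> t * ennreal (g t powr (1 / r - 1)) * (if 0 < t \<and> t < x then 1 else 0)) \<partial>lborel)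
        = (\<integral>\<^sup>+x. (\<phi> t * ennreal (g t powr (1 / r - 1)) * indicator {0<..} t) * (H x * indicator {t<..} x) \<partial>lborel)"
      by (intro nn_integral_cong) (auto simp: mult_ac split: split_indicator)
    also have "\<dots> = (\<phi> t * ennreal (g t powr (1 / r - 1)) * indicator {0<..} t) * (\<integral>\<^sup>+x\<in>{t<..}. H x \<partial>lborel)"
      by (rule nn_integral_cmult) simp
    also have "\<dots> = m t"
    proof (cases "t > 0")
      case True
      have "ennreal (g t powr (1 / r - 1)) * ennreal (g t) = ennreal (g t powr (1 / r))"
        using g[OF True] by (simp add: powr_diff flip: ennreal_mult)
      then show ?thesis using G[OF True] True by (simp add: m_def mult.assoc)
    qed (simp add: m_def)
    finally show "(\<integral>\<^sup>+x. H x * (\<phi> t * ennreal (g t powr (1 / r - 1)) * (if 0 < t \<and> t < x then 1 else 0)) \<partial>lborel) = m t" .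
  qed
  also have "\<dots> = D" unfolding D_def m_def ..
  also have "D * epowr D (r - 1) = epowr D r"
  proof -
    have "D < \<top>" using fin unfolding D_def by simp
    then obtain d where d: "D = ennreal d" "0 \<le> d" by (cases D) auto
    then show ?thesis
      by (cases "d = 0") (auto simp: epowr_ennreal powr_diff simp flip: ennreal_mult)
  qed
  finally show ?thesis unfolding D_def .
qed

lemma nn_integral_powr_from_0:
  assumes "-1 < a" "0 \<le> c"
  shows "(\<integral>\<^sup>+y\<in>{0<..<c}. ennreal (y powr a) \<partial>lborel) = ennreal (c powr (a + 1) / (a + 1))"
proof -
  have "((\<lambda>y. y powr a) has_integral (c powr (a + 1) / (a + 1))) {0..c}"
    using has_integral_powr_from_0[of a c] assms by simp
  then have "(\<integral>\<^sup>+y. ennreal (indicator {0..c} y * y powr a) \<partial>lborel) = ennreal (c powr (a + 1) / (a + 1))"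
    by (intro nn_integral_has_integral_lebesgue) auto
  moreover have "(\<integral>\<^sup>+y. ennreal (indicator {0..c} y * y powr a) \<partial>lborel) = (\<integral>\<^sup>+y\<in>{0<..<c}. ennreal (y powr a) \<partial>lborel)"
    using AE_lborel_singleton[of 0] AE_lborel_singleton[of c]
    by (intro nn_integral_cong_AE, eventually_elim) (auto split: split_indicator)
  ultimately show ?thesis by simp
qed

text \<open>The density \<open>k\<close> is determined by k^(p-1) = w^p / v. This is what turns m (w
  f / m)^p, with m the Hoelder weight, into f^p v times a power of the primitive of
  \<open>k\<close>, so that the weight on f in the conclusion is exactly v. The operator is already
  the arithmetic mean here, and neither the inverse of W nor the generating function is
  left.\<close>

lemma weighted_hardy_inequality:
  fixes p q s A :: real and w u v f :: "real \<Rightarrow> real"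
  defines "k \<equiv> \<lambda>t. v t powr (1 - conj_exp p) * w t powr conj_exp p"
  assumes par: "1 < p" "p \<le> q" "1 < s" "s < p" and A: "0 < A"
    and W: "positive_density w" and K: "positive_density k"
    and [measurable]: "u \<in> borel_measurable borel" "v \<in> borel_measurable borel" "f \<in> borel_measurable borel"
    and u: "\<And>x. 0 < x \<Longrightarrow> 0 < u x" and v: "\<And>x. 0 < x \<Longrightarrow> 0 < v x" and f: "\<And>x. 0 < x \<Longrightarrow> 0 \<le> f x"
    and bound: "\<And>t. 0 < t \<Longrightarrow> ennreal (primitive k t powr ((s - 1) / p)) *
        epowr (\<integral>\<^sup>+x\<in>{t<..}. ennreal (u x * primitive k x powr (q * (p - s) / p) / primitive w x powr q) \<partial>lborel) (1 / q)
        \<le> ennreal A"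
  shows "epowr (\<integral>\<^sup>+x\<in>{0<..}. ennreal (u x) *
        epowr ((\<integral>\<^sup>+t\<in>{0<..<x}. ennreal (w t * f t) \<partial>lborel) * ennreal (1 / primitive w x)) q \<partial>lborel) (1 / q)
    \<le> ennreal (((p - 1) / (p - s)) powr (1 / conj_exp p) * A) *
        epowr (\<integral>\<^sup>+x\<in>{0<..}. ennreal (v x * f x powr p) \<partial>lborel) (1 / p)"
proof -
  interpret W: positive_density w by fact
  interpret K: positive_density k by fact
  let ?K = "primitive k" and ?W = "primitive w"
  \<comment> \<open>This exponent is forced by \<theta> (p-1) = s - 1, so that the power of the
    primitive left in \<open>\<phi>\<close> is the one paired with the tail integral in
    A(s).\<close>
  define \<theta> where "\<theta> = (s - 1) / (p - 1)"
  define \<rho> where "\<rho> = (p - 1) / (p - s)"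
  define \<kappa> where "\<kappa> = \<rho> powr (1 / conj_exp p)"
  have \<rho>: "0 < \<rho>" using par by (simp add: \<rho>_def)
  have \<kappa>: "0 < \<kappa>" using \<rho> by (simp add: \<kappa>_def)
  have q: "0 < q" using par by simp
  have conj: "1 / conj_exp p = (p - 1) / p" "(1 - conj_exp p) * (p - 1) = - 1" "conj_exp p * (p - 1) = p"
    using par by (auto simp: conj_exp_def field_simps)
  have \<theta>: "- 1 < - \<theta>" "- \<theta> + 1 = (p - s) / (p - 1)" "\<theta> * (p - 1) = s - 1"
    using par by (auto simp: \<theta>_def field_simps)
  define m where "m t = ?K t powr (- \<theta>) * k t" for t
  have m_pos: "0 < m t" if "0 < t" for t
    using K.pos[OF that] K.primitive_pos[OF that] by (simp add: m_def)
  have [measurable]: "m \<in> borel_measurable borel" unfolding m_def by measurable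
  have total: "(\<integral>\<^sup>+t\<in>{0<..<x}. ennreal (m t) \<partial>lborel) = ennreal (\<rho> * ?K x powr ((p - s) / (p - 1)))" if x: "0 < x" for x
  proof -
    have "(\<integral>\<^sup>+t\<in>{0<..<x}. ennreal (m t) \<partial>lborel) = (\<integral>\<^sup>+t\<in>{0<..<x}. ennreal (?K t powr (- \<theta>)) * ennreal (k t) \<partial>lborel)"
      by (simp add: m_def ennreal_mult')
    also have "\<dots> = (\<integral>\<^sup>+y\<in>{0<..<?K x}. ennreal (y powr (- \<theta>)) \<partial>lborel)"
      by (rule K.nn_integral_substitution_primitive[of "\<lambda>y. ennreal (y powr (- \<theta>))", OF _ x]) simp
    also have "\<dots> = ennreal (?K x powr (- \<theta> + 1) / (- \<theta> + 1))"
      by (rule nn_integral_powr_from_0) (use \<theta> in auto)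
    also have "?K x powr (- \<theta> + 1) / (- \<theta> + 1) = \<rho> * ?K x powr ((p - s) / (p - 1))"
      unfolding \<theta> \<rho>_def by simp
    finally show ?thesis .
  qed
  define \<phi> where "\<phi> t = f t powr p * v t * ?K t powr (s - 1)" for t
  have [measurable]: "\<phi> \<in> borel_measurable borel" unfolding \<phi>_def by measurable
  have step1: "epowr (\<integral>\<^sup>+t\<in>{0<..<x}. ennreal (w t * f t) \<partial>lborel) p
      \<le> (\<integral>\<^sup>+t\<in>{0<..<x}. ennreal (\<phi> t) \<partial>lborel) * ennreal (\<rho> powr (p - 1) * ?K x powr (p - s))" if x: "0 < x" for x
  proof -
    let ?M = "density lborel (\<lambda>t. ennreal (m t) * indicator {0<..<x} t)"
    have tot: "emeasure ?M (space ?M) = ennreal (\<rho> * ?K x powr ((p - s) / (p - 1)))"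
      using total[OF x] by (simp add: emeasure_density)
    have "epowr (\<integral>\<^sup>+t. ennreal (w t * f t / m t) \<partial>?M) p
      \<le> (\<integral>\<^sup>+t. epowr (ennreal (w t * f t / m t)) p \<partial>?M) * epowr (emeasure ?M (space ?M)) (p - 1)"
      by (rule power_mean_inequality) (use par tot in auto)
    also have "(\<integral>\<^sup>+t. ennreal (w t * f t / m t) \<partial>?M) = (\<integral>\<^sup>+t\<in>{0<..<x}. ennreal (w t * f t) \<partial>lborel)"
    proof -
      have "ennreal (m t) * ennreal (w t * f t / m t) = ennreal (w t * f t)" if "0 < t" for t
        using m_pos[OF that] W.pos[OF that] f[OF that] by (simp flip: ennreal_mult)
      then show ?thesis
        by (subst nn_integral_density) (auto intro!: nn_integral_cong split: split_indicator)
    qed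
    also have "(\<integral>\<^sup>+t. epowr (ennreal (w t * f t / m t)) p \<partial>?M) = (\<integral>\<^sup>+t\<in>{0<..<x}. ennreal (\<phi> t) \<partial>lborel)"
    proof -
      have "ennreal (m t) * epowr (ennreal (w t * f t / m t)) p = ennreal (\<phi> t)" if t: "0 < t" for t
      proof -
        note pos = m_pos[OF t] W.pos[OF t] f[OF t] v[OF t] K.primitive_pos[OF t] K.pos[OF t]
        have "k t powr (p - 1) = w t powr p / v t"
          using pos by (simp add: k_def powr_mult powr_powr conj powr_minus_divide)
        then have "m t powr (p - 1) = ?K t powr (- (s - 1)) * (w t powr p / v t)"
          using pos \<theta>(3) by (simp add: m_def powr_mult powr_powr)
        then have inv: "1 / m t powr (p - 1) = ?K t powr (s - 1) * v t / w t powr p"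
          unfolding powr_minus_divide using pos by simp
        have "m t * (w t * f t / m t) powr p = w t powr p * f t powr p * (1 / m t powr (p - 1))"
          using pos by (simp add: powr_mult powr_divide powr_diff)
        also have "\<dots> = \<phi> t"
          unfolding inv using pos by (simp add: \<phi>_def)
        finally have "m t * (w t * f t / m t) powr p = \<phi> t" .
        then show ?thesis
          using pos by (simp add: epowr_ennreal flip: ennreal_mult)
      qed
      then show ?thesis
        by (subst nn_integral_density) (auto intro!: nn_integral_cong split: split_indicator)
    qed
    also have "epowr (emeasure ?M (space ?M)) (p - 1) = ennreal (\<rho> powr (p - 1) * ?K x powr (p - s))"
      using \<rho> par K.primitive_pos[OF x] unfolding tot by (simp add: epowr_ennreal powr_mult powr_powr)
    finally show ?thesis .
  qed
  define H where "H x = u x * ?K x powr (q * (p - s) / p) / ?W x powr q" for x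
  have [measurable]: "H \<in> borel_measurable borel" unfolding H_def by measurable
  have H_pos: "0 < H x" if "0 < x" for x
    using u[OF that] K.primitive_pos[OF that] W.primitive_pos[OF that] by (simp add: H_def)
  \<comment> \<open>A real-valued version of the tail integral, because
    \<open>minkowski_integral_triangle\<close> takes real powers of it. It loses nothing: for t > 0
    the tail is finite, since in \<open>bound\<close> it is multiplied by a positive power of
    \<open>primitive k t\<close>.\<close>
  define g where "g t = enn2real (\<integral>\<^sup>+x. (if t < x then ennreal (H x) else 0) \<partial>lborel)" for t
  have [measurable]: "g \<in> borel_measurable borel" unfolding g_def by measurable
  have int_eq: "(\<integral>\<^sup>+x. (if t < x then ennreal (H x) else 0) \<partial>lborel) = (\<integral>\<^sup>+x\<in>{t<..}. ennreal (H x) \<partial>lborel)" for t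
    by (intro nn_integral_cong) (auto split: split_indicator)
  have G: "(\<integral>\<^sup>+x\<in>{t<..}. ennreal (H x) \<partial>lborel) = ennreal (g t)" and g_pos: "0 < g t" if t: "0 < t" for t
  proof -
    have "(\<integral>\<^sup>+x\<in>{t<..}. ennreal (H x) \<partial>lborel) \<noteq> \<top>"
    proof
      assume "(\<integral>\<^sup>+x\<in>{t<..}. ennreal (H x) \<partial>lborel) = \<top>"
      then show False
        using bound[OF t] K.primitive_pos[OF t] by (simp add: H_def ennreal_mult_top top_unique)
    qed
    then show 1: "(\<integral>\<^sup>+x\<in>{t<..}. ennreal (H x) \<partial>lborel) = ennreal (g t)"
      unfolding g_def int_eq by (simp add: less_top)
    have "(\<integral>\<^sup>+x\<in>{t<..}. ennreal (H x) \<partial>lborel) \<noteq> 0"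
      using H_pos t by (intro nn_integral_Ioi_nonzero) (auto simp: ennreal_eq_0_iff not_le)
    then show "0 < g t"
      unfolding 1 by (simp add: ennreal_eq_0_iff)
  qed
  \<comment> \<open>The p-th power of \<open>bound\<close>. The exponent p/q is the 1/r of
    Minkowski's inequality for r = q/p.\<close>
  have g_bound: "?K t powr (s - 1) * g t powr (p / q) \<le> A powr p" if t: "0 < t" for t
  proof -
    have "ennreal (?K t powr ((s - 1) / p) * g t powr (1 / q)) \<le> ennreal A"
      using bound[OF t] G[OF t] g_pos[OF t] by (simp add: H_def epowr_ennreal flip: ennreal_mult)
    then have "?K t powr ((s - 1) / p) * g t powr (1 / q) \<le> A"
      using A by (subst (asm) ennreal_le_iff) auto
    then have "(?K t powr ((s - 1) / p) * g t powr (1 / q)) powr p \<le> A powr p"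
      using par by (intro powr_mono2) auto
    then show ?thesis
      using par by (simp add: powr_mult powr_powr)
  qed
  define F where "F = (\<integral>\<^sup>+x\<in>{0<..}. ennreal (v x * f x powr p) \<partial>lborel)"
  show ?thesis
  proof (cases "F = \<top>")
    case True
    then show ?thesis
      using \<kappa> A by (simp add: F_def \<kappa>_def \<rho>_def ennreal_mult_top)
  next
    case False
    let ?D = "\<integral>\<^sup>+t\<in>{0<..}. ennreal (\<phi> t) * ennreal (g t powr (1 / (q / p))) \<partial>lborel"
    have D_le: "?D \<le> ennreal (A powr p) * F"
    proof -
      have "?D \<le> (\<integral>\<^sup>+t. ennreal (A powr p) * (ennreal (v t * f t powr p) * indicator {0<..} t) \<partial>lborel)"
      proof (rule nn_integral_mono)
        fix t
        show "ennreal (\<phi> t) * ennreal (g t powr (1 / (q / p))) * indicator {0<..} t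
          \<le> ennreal (A powr p) * (ennreal (v t * f t powr p) * indicator {0<..} t)"
        proof (cases "0 < t")
          case True
          note pos = f[OF True] v[OF True]
          have "\<phi> t * g t powr (p / q) = (v t * f t powr p) * (?K t powr (s - 1) * g t powr (p / q))"
            by (simp add: \<phi>_def)
          also have "\<dots> \<le> (v t * f t powr p) * A powr p"
            using pos by (intro mult_left_mono g_bound[OF True]) auto
          finally have "ennreal (\<phi> t * g t powr (p / q)) \<le> ennreal (A powr p * (v t * f t powr p))"
            by (intro ennreal_leI) (simp add: mult_ac)
          moreover have "0 \<le> \<phi> t" using pos by (simp add: \<phi>_def)
          ultimately show ?thesis using True pos by (simp add: ennreal_mult)
        qed simp
      qed
      also have "\<dots> = ennreal (A powr p) * F"
        unfolding F_def by (rule nn_integral_cmult) simp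
      finally show ?thesis .
    qed
    have D_fin: "?D < \<infinity>"
      using D_le False by (auto simp: less_top[symmetric] top_unique ennreal_mult_eq_top_iff)
    have mink: "(\<integral>\<^sup>+x\<in>{0<..}. ennreal (H x) * epowr (\<integral>\<^sup>+t\<in>{0<..<x}. ennreal (\<phi> t) \<partial>lborel) (q / p) \<partial>lborel)
        \<le> epowr ?D (q / p)"
      by (rule minkowski_integral_triangle) (use par G g_pos D_fin in auto)
    have pt: "ennreal (u x) * epowr ((\<integral>\<^sup>+t\<in>{0<..<x}. ennreal (w t * f t) \<partial>lborel) * ennreal (1 / ?W x)) q
        \<le> ennreal (\<kappa> powr q) * (ennreal (H x) * epowr (\<integral>\<^sup>+t\<in>{0<..<x}. ennreal (\<phi> t) \<partial>lborel) (q / p))"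
      if x: "0 < x" for x
    proof -
      let ?I = "\<integral>\<^sup>+t\<in>{0<..<x}. ennreal (w t * f t) \<partial>lborel" and ?\<Phi> = "\<integral>\<^sup>+t\<in>{0<..<x}. ennreal (\<phi> t) \<partial>lborel"
      note pos = u[OF x] W.primitive_pos[OF x] K.primitive_pos[OF x]
      have "epowr ?I q = epowr (epowr ?I p) (q / p)"
        using par by (simp add: epowr_epowr)
      also have "\<dots> \<le> epowr (?\<Phi> * ennreal (\<rho> powr (p - 1) * ?K x powr (p - s))) (q / p)"
        using par by (intro epowr_mono step1 x) auto
      also have "\<dots> = epowr ?\<Phi> (q / p) * ennreal ((\<rho> powr (p - 1) * ?K x powr (p - s)) powr (q / p))"
        using par by (simp add: epowr_mult epowr_ennreal)
      \<comment> \<open>Since 1/p' = (p-1)/p, the factor (\<rho>^(p-1))^(q/p) is the q-th power of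
        \<open>\<kappa>\<close>.\<close>
      also have "(\<rho> powr (p - 1) * ?K x powr (p - s)) powr (q / p) = \<kappa> powr q * ?K x powr (q * (p - s) / p)"
        unfolding \<kappa>_def conj by (simp add: powr_mult powr_powr mult_ac)
      finally have "ennreal (u x) * (epowr ?I q * ennreal (1 / ?W x powr q))
        \<le> ennreal (u x) * (epowr ?\<Phi> (q / p) * ennreal (\<kappa> powr q * ?K x powr (q * (p - s) / p)) * ennreal (1 / ?W x powr q))"
        by (intro mult_left_mono mult_right_mono) auto
      also have "\<dots> = epowr ?\<Phi> (q / p) * (ennreal (u x) * (ennreal (\<kappa> powr q * ?K x powr (q * (p - s) / p)) * ennreal (1 / ?W x powr q)))"
        by (simp add: mult_ac)
      also have "ennreal (u x) * (ennreal (\<kappa> powr q * ?K x powr (q * (p - s) / p)) * ennreal (1 / ?W x powr q)) = ennreal (\<kappa> powr q) * ennreal (H x)"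
        using pos by (simp add: H_def mult_ac flip: ennreal_mult)
      finally show ?thesis
        using q pos by (simp add: epowr_mult epowr_ennreal powr_divide mult_ac)
    qed
    have "(\<integral>\<^sup>+x\<in>{0<..}. ennreal (u x) * epowr ((\<integral>\<^sup>+t\<in>{0<..<x}. ennreal (w t * f t) \<partial>lborel) * ennreal (1 / ?W x)) q \<partial>lborel)
      \<le> (\<integral>\<^sup>+x. ennreal (\<kappa> powr q) * (ennreal (H x) * epowr (\<integral>\<^sup>+t\<in>{0<..<x}. ennreal (\<phi> t) \<partial>lborel) (q / p) * indicator {0<..} x) \<partial>lborel)"
      using pt by (intro nn_integral_mono) (auto split: split_indicator)
    also have "\<dots> = ennreal (\<kappa> powr q) * (\<integral>\<^sup>+x\<in>{0<..}. ennreal (H x) * epowr (\<integral>\<^sup>+t\<in>{0<..<x}. ennreal (\<phi> t) \<partial>lborel) (q / p) \<partial>lborel)"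
      by (rule nn_integral_cmult) measurable
    also have "\<dots> \<le> ennreal (\<kappa> powr q) * epowr (ennreal (A powr p) * F) (q / p)"
      using mink epowr_mono[OF _ D_le, of "q / p"] par by (intro mult_left_mono) (auto intro: order_trans)
    finally have "epowr (\<integral>\<^sup>+x\<in>{0<..}. ennreal (u x) * epowr ((\<integral>\<^sup>+t\<in>{0<..<x}. ennreal (w t * f t) \<partial>lborel) * ennreal (1 / ?W x)) q \<partial>lborel) (1 / q)
      \<le> epowr (ennreal (\<kappa> powr q) * epowr (ennreal (A powr p) * F) (q / p)) (1 / q)"
      using q by (intro epowr_mono) auto
    also have "\<dots> = ennreal (\<kappa> * A) * epowr F (1 / p)"
      using q par \<kappa> A by (simp add: epowr_mult epowr_epowr epowr_ennreal powr_powr ennreal_mult mult.assoc)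
    finally show ?thesis
      unfolding F_def \<kappa>_def \<rho>_def .
  qed
qed

section \<open>Quasi-arithmetic means\<close>

text \<open>If X stayed strictly on one side of its expectation everywhere, the expectation would be
  strictly smaller than itself. Bounds by attained values place an expectation inside any interval
  containing the values, even an open or unbounded one.\<close>

lemma (in prob_space) expectation_between_values:
  fixes X :: "'a \<Rightarrow> real"
  assumes X: "integrable M X"
  shows "\<exists>x\<in>space M. X x \<le> expectation X" "\<exists>x\<in>space M. expectation X \<le> X x"
proof -
  show "\<exists>x\<in>space M. X x \<le> expectation X"
  proof (rule ccontr)
    assume "\<not> ?thesis"
    then have "AE x in M. expectation X < X x" by (intro AE_I2) auto
    then have "expectation X < expectation X" by (rule expectation_greater[OF X])
    then show False by simp
  qed
  show "\<exists>x\<in>space M. expectation X \<le> X x"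
  proof (rule ccontr)
    assume "\<not> ?thesis"
    then have "AE x in M. X x < expectation X" by (intro AE_I2) auto
    then have "expectation X < expectation X" by (rule expectation_less[OF X])
    then show False by simp
  qed
qed

text \<open>These are the shapes of interval under which Jensen's inequality is applied
  below.\<close>

lemma einterval_cases:
  obtains "einterval a b = {}" | c d :: real where "einterval a b = {c<..<d}" | c :: real where "einterval a b = {c<..}"
    | d :: real where "einterval a b = {..<d}" | "einterval a b = UNIV"
proof -
  consider "b = -\<infinity>" | "a = \<infinity>" | "a = -\<infinity>" "b = \<infinity>" | d where "a = -\<infinity>" "b = ereal d" | c where "a = ereal c" "b = \<infinity>"
    | c d where "a = ereal c" "b = ereal d"
    by (cases a; cases b) auto
  then show thesis
    by cases (use that in \<open>auto simp: einterval_def greaterThanLessThan_def lessThan_def greaterThan_def\<close>)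
qed

text \<open>Jensen's inequality puts the expectation of g(X) above g(E X), and some value g(X y)
  lies above that expectation. The intermediate value theorem between X y and E X then produces c
  with g(c) equal to it. So the expectation is in the range of g, and c is at most E X and at least
  X y, hence nonnegative.\<close>

lemma (in prob_space) quasi_arithmetic_mean_convex:
  fixes g :: "real \<Rightarrow> real" and X :: "'a \<Rightarrow> real"
  assumes X: "integrable M X" "\<And>x. x \<in> space M \<Longrightarrow> X x \<in> einterval a b" "\<And>x. x \<in> space M \<Longrightarrow> 0 \<le> X x"
    and gX: "integrable M (\<lambda>x. g (X x))"
    and g: "continuous_on (einterval a b) g" "convex_on (einterval a b) g" "strict_antimono_on (einterval a b) g"
  shows "0 \<le> the_inv_into (einterval a b) g (expectation (\<lambda>x. g (X x)))
    \<and> the_inv_into (einterval a b) g (expectation (\<lambda>x. g (X x))) \<le> expectation X"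
proof -
  let ?I = "einterval a b"
  obtain x1 x2 where x12: "x1 \<in> space M" "x2 \<in> space M" "X x1 \<le> expectation X" "expectation X \<le> X x2"
    using expectation_between_values[OF X(1)] by blast
  have conv: "{s..t} \<subseteq> ?I" if "s \<in> ?I" "t \<in> ?I" for s t
    using that by (auto simp: einterval_iff intro: less_le_trans le_less_trans) (metis ereal_less_eq(3) less_le_trans le_less_trans)+
  have EI: "expectation X \<in> ?I"
    using conv[of "X x1" "X x2"] x12 X(2) by auto
  have le: "g (expectation X) \<le> expectation (\<lambda>x. g (X x))"
  proof (rule einterval_cases[of a b])
    assume "?I = {}" then show ?thesis using EI by simp
  qed (rule jensens_inequality[OF X(1) _ _ gX g(2)], use X(2) in auto)+
  \<comment> \<open>An attained value serves as the second endpoint; as g decreases, it has to lie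
    to the left of the expectation of X.\<close>
  obtain y where y: "y \<in> space M" "expectation (\<lambda>x. g (X x)) \<le> g (X y)"
    using expectation_between_values(2)[OF gX] by blast
  have yE: "X y \<le> expectation X"
  proof (rule ccontr)
    assume "\<not> ?thesis"
    then have "g (X y) < g (expectation X)"
      using monotone_onD[OF g(3) EI X(2)[OF y(1)]] by simp
    with le y show False by simp
  qed
  obtain c where c: "X y \<le> c" "c \<le> expectation X" "g c = expectation (\<lambda>x. g (X x))"
    using IVT2'[of g "expectation X" "expectation (\<lambda>x. g (X x))" "X y"] le y yE
      continuous_on_subset[OF g(1) conv[OF X(2)[OF y(1)] EI]] by blast
  have "inj_on g ?I"
  proof (rule inj_onI)
    fix s t assume "s \<in> ?I" "t \<in> ?I" "g s = g t"
    then show "s = t"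
      using monotone_onD[OF g(3), of s t] monotone_onD[OF g(3), of t s] by (cases s t rule: linorder_cases) auto
  qed
  moreover have "c \<in> ?I"
    using conv[OF X(2)[OF y(1)] EI] c by auto
  ultimately have "the_inv_into ?I g (expectation (\<lambda>x. g (X x))) = c"
    using c(3) by (metis the_inv_into_f_f)
  then show ?thesis using c X(3)[OF y(1)] by auto
qed

text \<open>The concave increasing case reduces to the convex decreasing one because g and -g
  generate the same mean.\<close>

lemma (in prob_space) quasi_arithmetic_mean_le:
  fixes g :: "real \<Rightarrow> real" and X :: "'a \<Rightarrow> real"
  assumes X: "integrable M X" "\<And>x. x \<in> space M \<Longrightarrow> X x \<in> einterval a b" "\<And>x. x \<in> space M \<Longrightarrow> 0 \<le> X x"
    and gX: "integrable M (\<lambda>x. g (X x))"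
    and g: "continuous_on (einterval a b) g" "(convex_on (einterval a b) g \<and> strict_antimono_on (einterval a b) g) \<or>
         (concave_on (einterval a b) g \<and> strict_mono_on (einterval a b) g)"
  shows "0 \<le> the_inv_into (einterval a b) g (expectation (\<lambda>x. g (X x)))
    \<and> the_inv_into (einterval a b) g (expectation (\<lambda>x. g (X x))) \<le> expectation X"
  using g(2)
proof
  assume "convex_on (einterval a b) g \<and> strict_antimono_on (einterval a b) g"
  then show ?thesis using quasi_arithmetic_mean_convex[OF X gX g(1)] by blast
next
  assume conc: "concave_on (einterval a b) g \<and> strict_mono_on (einterval a b) g"
  let ?h = "\<lambda>x. - g x"
  have "integrable M (\<lambda>x. ?h (X x))" using gX by simp
  moreover have "continuous_on (einterval a b) ?h" using g(1) by (intro continuous_intros)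
  moreover have "convex_on (einterval a b) ?h" using conc by (simp add: concave_on_def)
  moreover have "strict_antimono_on (einterval a b) ?h"
    using conc by (auto simp: monotone_on_def)
  ultimately have "0 \<le> the_inv_into (einterval a b) ?h (expectation (\<lambda>x. ?h (X x)))
    \<and> the_inv_into (einterval a b) ?h (expectation (\<lambda>x. ?h (X x))) \<le> expectation X"
    using quasi_arithmetic_mean_convex[where g="?h" and X=X and a=a and b=b] X by blast
  moreover have "the_inv_into (einterval a b) ?h (- c) = the_inv_into (einterval a b) g c" for c
    by (simp add: the_inv_into_def)
  ultimately show ?thesis by simp
qed

text \<open>With density w / W(x) the interval (0,x) becomes a probability space on which
  \<open>wmean\<close> is a quasi-arithmetic mean of f. Assumption \<open>fin\<close> makes f
  integrable there; if the integral is infinite, the upper bound needed later is trivial.\<close>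

lemma wmean_le_mean:
  fixes g w f :: "real \<Rightarrow> real"
  assumes w: "weight w" and c: "0 < cumul w x" "(\<integral>\<^sup>+t\<in>{0<..<x}. ennreal (w t) \<partial>lborel) = ennreal (cumul w x)"
    and g: "continuous_on (einterval a b) g" "(convex_on (einterval a b) g \<and> strict_antimono_on (einterval a b) g) \<or>
         (concave_on (einterval a b) g \<and> strict_mono_on (einterval a b) g)"
    and f: "f \<in> borel_measurable (lebesgue_on {0<..})" "\<And>x. 0 < x \<Longrightarrow> 0 \<le> f x" "wmean_defined a b g w f"
    and fin: "(\<integral>\<^sup>+t\<in>{0<..<x}. ennreal (w t * f t) \<partial>lborel) < \<infinity>" and x: "0 < x"
  shows "0 \<le> wmean a b g w f x"
    and "ennreal (wmean a b g w f x) \<le> (\<integral>\<^sup>+t\<in>{0<..<x}. ennreal (w t * f t) \<partial>lborel) * ennreal (1 / cumul w x)"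
proof -
  let ?L = "lebesgue_on {0<..<x}" and ?c = "cumul w x"
  let ?M = "density ?L (\<lambda>t. ennreal (w t / ?c))"
  have sub: "h \<in> borel_measurable ?L" if "h \<in> borel_measurable (lebesgue_on {0<..})" for h :: "real \<Rightarrow> real"
    by (rule measurable_restrict_mono[OF that]) auto
  have w_pos: "0 < w t" if "0 < t" for t
    using w that by (simp add: weight_def)
  have [measurable]: "w \<in> borel_measurable ?L" "f \<in> borel_measurable ?L"
    using w by (simp_all add: weight_def sub f(1))
  have nnL: "(\<integral>\<^sup>+t. h t \<partial>?L) = (\<integral>\<^sup>+t\<in>{0<..<x}. h t \<partial>lborel)" for h
    by (subst nn_integral_restrict_space) (auto simp: nn_integral_completion)
  have "prob_space ?M"
  proof (rule prob_spaceI)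
    have "emeasure ?M (space ?M) = (\<integral>\<^sup>+t. ennreal (w t / ?c) \<partial>?L)"
      by (subst emeasure_density) (auto intro!: nn_integral_cong)
    also have "\<dots> = (\<integral>\<^sup>+t. ennreal (1 / ?c) * ennreal (w t) \<partial>?L)"
      using c(1) by (intro nn_integral_cong) (simp flip: ennreal_mult')
    also have "\<dots> = ennreal (1 / ?c) * (\<integral>\<^sup>+t. ennreal (w t) \<partial>?L)"
      by (rule nn_integral_cmult) simp
    also have "\<dots> = 1"
      unfolding nnL c(2) using c(1) by (simp flip: ennreal_mult)
    finally show "emeasure ?M (space ?M) = 1" .
  qed
  then interpret M: prob_space ?M .
  have int_wg: "integrable ?L (\<lambda>t. w t * g (f t))"
    using f(3) x unfolding wmean_defined_def set_integrable_def by (subst integrable_restrict_space) auto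
  \<comment> \<open>Integrability is given for the product w (g \<circ> f); dividing by the positive
    w recovers measurability of g \<circ> f itself.\<close>
  then have "(\<lambda>t. w t * g (f t) / w t) \<in> borel_measurable ?L"
    by (intro borel_measurable_divide) auto
  moreover have "w t * g (f t) / w t = g (f t)" if "t \<in> space ?L" for t
    using that w_pos[of t] by auto
  ultimately have [measurable]: "(\<lambda>t. g (f t)) \<in> borel_measurable ?L"
    by (subst measurable_cong[symmetric]) auto
  have nonneg: "AE t in ?L. 0 \<le> w t / ?c"
    using c(1) by (intro AE_I2 divide_nonneg_pos) (auto simp: less_imp_le[OF w_pos])
  have expect: "integral\<^sup>L ?M h = (1 / ?c) * (LINT t|?L. w t * h t)" "integrable ?M h \<longleftrightarrow> integrable ?L (\<lambda>t. w t * h t)"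
    if "h \<in> borel_measurable ?L" for h
  proof -
    have eq: "(\<lambda>t. (w t / ?c) *\<^sub>R h t) = (\<lambda>t. 1 / ?c * (w t * h t))" by auto
    show "integral\<^sup>L ?M h = (1 / ?c) * (LINT t|?L. w t * h t)"
      using integral_density[OF that _ nonneg] unfolding eq by simp
    show "integrable ?M h \<longleftrightarrow> integrable ?L (\<lambda>t. w t * h t)"
    proof -
      have "integrable ?M h \<longleftrightarrow> integrable ?L (\<lambda>t. 1 / ?c * (w t * h t))"
        using integrable_density[OF that _ nonneg] unfolding eq by simp
      also have "\<dots> \<longleftrightarrow> integrable ?L (\<lambda>t. w t * h t)"
        using c(1) by (subst integrable_mult_left_iff) simp
      finally show ?thesis .
    qed
  qed
  have wf: "0 \<le> w t * f t" if "0 < t" for t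
    using w_pos[OF that] f(2)[OF that] by simp
  have int_wf: "integrable ?L (\<lambda>t. w t * f t)"
  proof (rule integrableI_nonneg)
    show "AE t in ?L. 0 \<le> w t * f t"
      by (intro AE_I2) (simp add: wf)
  qed (use fin in \<open>auto simp: nnL\<close>)
  have "wmean a b g w f x = the_inv_into (einterval a b) g (M.expectation (\<lambda>t. g (f t)))"
    unfolding wmean_def set_lebesgue_integral_def using expect(1)[of "\<lambda>t. g (f t)"]
    by (simp add: integral_restrict_space)
  moreover have "0 \<le> the_inv_into (einterval a b) g (M.expectation (\<lambda>t. g (f t)))
    \<and> the_inv_into (einterval a b) g (M.expectation (\<lambda>t. g (f t))) \<le> M.expectation f"
  proof (rule M.quasi_arithmetic_mean_le[OF _ _ _ _ g])
    show "integrable ?M f" "integrable ?M (\<lambda>t. g (f t))"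
      using expect(2) int_wf int_wg by auto
    show "f t \<in> einterval a b" "0 \<le> f t" if "t \<in> space ?M" for t
      using that f x by (auto simp: wmean_defined_def)
  qed
  moreover have "ennreal (M.expectation f) = (\<integral>\<^sup>+t\<in>{0<..<x}. ennreal (w t * f t) \<partial>lborel) * ennreal (1 / ?c)"
  proof -
    have "0 \<le> (LINT t|?L. w t * f t)"
      by (intro integral_nonneg_AE AE_I2) (simp add: wf)
    moreover have "ennreal (LINT t|?L. w t * f t) = (\<integral>\<^sup>+t\<in>{0<..<x}. ennreal (w t * f t) \<partial>lborel)"
      by (subst nn_integral_eq_integral[symmetric, OF int_wf]) (auto simp: nnL wf intro!: AE_I2)
    moreover have "M.expectation f = (LINT t|?L. w t * f t) * (1 / ?c)"
      using expect(1)[of f] by simp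
    ultimately show ?thesis
      using c(1) by (metis ennreal_mult divide_nonneg_pos zero_le_one)
  qed
  ultimately show "0 \<le> wmean a b g w f x"
    and "ennreal (wmean a b g w f x) \<le> (\<integral>\<^sup>+t\<in>{0<..<x}. ennreal (w t * f t) \<partial>lborel) * ennreal (1 / cumul w x)"
    by (simp, metis ennreal_leI)
qed

section \<open>The generalized weighted mean inequality\<close>

text \<open>The supremum defining A(s) is bounded below by its term at W(t), which is rewritten by
  the substitution y = W(x). The transported weights only occur under integrals, so it is enough
  that they agree almost everywhere with their Borel forms over w.\<close>

lemma A_const_lower_bound:
  fixes w u v w0 u0 v0 :: "real \<Rightarrow> real" and p q s t :: real
  assumes "unbounded_density w0" and cumul: "cumul w = primitive w0"
    and [measurable]: "u0 \<in> borel_measurable borel" "v0 \<in> borel_measurable borel"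
    and u0: "\<And>x. 0 < u0 x" "AE x in lborel. 0 < x \<longrightarrow> u x = u0 x"
    and v0: "\<And>x. 0 < v0 x" "AE x in lborel. 0 < x \<longrightarrow> v x = v0 x"
    and t: "0 < t"
  defines "\<sigma> \<equiv> \<lambda>x. \<integral>\<^sup>+t\<in>{0<..<x}. ennreal (v0 t powr (1 - conj_exp p) * w0 t powr conj_exp p) \<partial>lborel"
  shows "epowr (\<sigma> t) ((s - 1) / p) *
      epowr (\<integral>\<^sup>+x\<in>{t<..}. ennreal (u0 x) * epowr (\<sigma> x) (q * (p - s) / p) / ennreal (primitive w0 x powr q) \<partial>lborel) (1 / q)
    \<le> A_const p q (transport w u) (transport w v) s"
proof -
  interpret W: unbounded_density w0 by fact
  let ?W = "primitive w0"
  have inv: "cumul_inv w y = W.inv_primitive y" if "0 < y" for y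
    using that by (simp add: cumul_inv_def cumul W.inv_primitive_def)
  have "AE x in lborel. 0 < x \<longrightarrow> deriv (cumul w) x = w0 x"
    using W.primitive_has_derivative_AE by eventually_elim (simp add: cumul DERIV_imp_deriv)
  then have deriv: "AE y in lborel. 0 < y \<longrightarrow> deriv (cumul w) (W.inv_primitive y) = w0 (W.inv_primitive y)"
    by (rule W.AE_inv_primitive)
  have U: "AE y in lborel. 0 < y \<longrightarrow> transport w u y = u0 (W.inv_primitive y) / w0 (W.inv_primitive y)"
    using deriv W.AE_inv_primitive[OF u0(2)] by eventually_elim (simp add: transport_def inv)
  have V: "AE y in lborel. 0 < y \<longrightarrow> transport w v y = v0 (W.inv_primitive y) / w0 (W.inv_primitive y)"
    using deriv W.AE_inv_primitive[OF v0(2)] by eventually_elim (simp add: transport_def inv)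
  have Vt: "Vtilde p (transport w v) (?W x) = \<sigma> x" if x: "0 < x" for x
  proof -
    let ?h = "\<lambda>x'. ennreal ((v0 x' / w0 x') powr (1 - conj_exp p)) * indicator {..<x} x'"
    have "Vtilde p (transport w v) (?W x) = (\<integral>\<^sup>+y\<in>{0<..}. ?h (W.inv_primitive y) \<partial>lborel)"
      unfolding Vtilde_def nn_integral_completion using V
      by (intro nn_integral_cong_AE, eventually_elim)
        (use x in \<open>auto split: split_indicator simp: W.inv_primitive_less_iff\<close>)
    also have "\<dots> = (\<integral>\<^sup>+x'\<in>{0<..}. ?h x' * ennreal (w0 x') \<partial>lborel)"
      by (rule W.nn_integral_inv_primitive) simp
    also have "\<dots> = \<sigma> x"
    proof -
      have "ennreal ((v0 t / w0 t) powr (1 - conj_exp p)) * ennreal (w0 t)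
          = ennreal (v0 t powr (1 - conj_exp p) * w0 t powr conj_exp p)" if "0 < t" for t
      proof -
        \<comment> \<open>The Jacobian w combines with (v/w)^(1-p') to give v^(1-p') w^p', the
          density of \<sigma>.\<close>
        have "w0 t powr conj_exp p = w0 t / w0 t powr (1 - conj_exp p)"
          using W.pos[OF that] by (simp add: powr_diff)
        then show ?thesis
          using W.pos[OF that] v0(1)[of t] by (simp add: powr_divide flip: ennreal_mult)
      qed
      then show ?thesis
        unfolding \<sigma>_def by (intro nn_integral_cong) (auto split: split_indicator)
    qed
    finally show ?thesis .
  qed
  have [measurable]: "\<sigma> \<in> borel_measurable borel"
    unfolding \<sigma>_def by measurable
  let ?H = "\<lambda>x. ennreal (u0 x / w0 x) * epowr (\<sigma> x) (q * (p - s) / p) / ennreal (?W x powr q) * indicator {t<..} x"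
  have "(\<integral>\<^sup>+y\<in>{?W t<..}. ennreal (transport w u y) * epowr (Vtilde p (transport w v) y) (q * (p - s) / p)
                              / ennreal (y powr q) \<partial>lebesgue)
      = (\<integral>\<^sup>+y\<in>{0<..}. ?H (W.inv_primitive y) \<partial>lborel)"
    unfolding nn_integral_completion using U
  proof (intro nn_integral_cong_AE, eventually_elim)
    case (elim y)
    show ?case
    proof (cases "0 < y")
      case True
      \<comment> \<open>Holds at every y > 0, since each such y is a value of W.\<close>
      have "Vtilde p (transport w v) y = \<sigma> (W.inv_primitive y)"
        using Vt[of "W.inv_primitive y"] True W.inv_primitive_pos by simp
      with True elim t show ?thesis
        by (auto split: split_indicator simp: W.less_inv_primitive_iff)
    next
      case False
      then show ?thesis using W.primitive_pos[OF t] by (auto split: split_indicator)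
    qed
  qed
  also have "\<dots> = (\<integral>\<^sup>+x\<in>{0<..}. ?H x * ennreal (w0 x) \<partial>lborel)"
    by (rule W.nn_integral_inv_primitive) measurable
  also have "\<dots> = (\<integral>\<^sup>+x\<in>{t<..}. ennreal (u0 x) * epowr (\<sigma> x) (q * (p - s) / p) / ennreal (?W x powr q) \<partial>lborel)"
  proof -
    have "ennreal (u0 x / w0 x) * epowr (\<sigma> x) (q * (p - s) / p) / ennreal (?W x powr q) * ennreal (w0 x)
        = ennreal (u0 x) * epowr (\<sigma> x) (q * (p - s) / p) / ennreal (?W x powr q)" if "0 < x" for x
    proof -
      have "ennreal (u0 x / w0 x) * ennreal (w0 x) = ennreal (u0 x)"
        using W.pos[OF that] u0(1)[of x] by (simp flip: ennreal_mult)
      then show ?thesis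
        by (simp add: divide_ennreal_def mult_ac) (metis mult.assoc)
    qed
    then show ?thesis
      using t by (intro nn_integral_cong) (auto split: split_indicator)
  qed
  finally have "epowr (\<sigma> t) ((s - 1) / p) *
      epowr (\<integral>\<^sup>+x\<in>{t<..}. ennreal (u0 x) * epowr (\<sigma> x) (q * (p - s) / p) / ennreal (?W x powr q) \<partial>lborel) (1 / q)
    = epowr (Vtilde p (transport w v) (?W t)) ((s - 1) / p) *
        epowr (\<integral>\<^sup>+y\<in>{?W t<..}. ennreal (transport w u y) * epowr (Vtilde p (transport w v) y) (q * (p - s) / p)
                              / ennreal (y powr q) \<partial>lebesgue) (1 / q)"
    using Vt[OF t] by simp
  also have "\<dots> \<le> A_const p q (transport w u) (transport w v) s"
    unfolding A_const_def using W.primitive_pos[OF t] by (intro SUP_upper) simp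
  finally show ?thesis .
qed

text \<open>The slack \<open>e\<close> yields a strictly positive constant even if \<open>A\<close>
  is 0, as \<open>weighted_hardy_inequality\<close> and the admissible constants require.\<close>

lemma wmean_ineq_of_A_const:
  fixes p q s e :: real and a b :: ereal and g w u v :: "real \<Rightarrow> real"
  assumes par: "1 < p" "p \<le> q" "1 < s" "s < p" and e: "0 < e"
    and g: "continuous_on (einterval a b) g"
      "(convex_on (einterval a b) g \<and> strict_antimono_on (einterval a b) g) \<or>
         (concave_on (einterval a b) g \<and> strict_mono_on (einterval a b) g)"
    and w: "weight w" "\<And>x. x > 0 \<Longrightarrow> (\<integral>\<^sup>+t\<in>{0<..<x}. ennreal (w t) \<partial>lebesgue) < \<infinity>"
      "(\<integral>\<^sup>+t\<in>{0<..}. ennreal (w t) \<partial>lebesgue) = \<infinity>"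
    and u: "weight u" and v: "weight v"
    and A: "A_const p q (transport w u) (transport w v) s = ennreal A" "0 \<le> A"
  shows "wmean_ineq p q a b g w u v (((p - 1) / (p - s)) powr (1 / conj_exp p) * (A + e))"
proof -
  have rep: "\<exists>h0. h0 \<in> borel_measurable borel \<and> (\<forall>x. 0 < h0 x) \<and> (AE x in lborel. 0 < x \<longrightarrow> h x = h0 x)"
    if "weight h" for h
  proof -
    have m: "h \<in> borel_measurable (lebesgue_on {0<..})" and pos: "\<And>x. 0 < x \<Longrightarrow> h x \<in> {0<..}"
      using that by (auto simp: weight_def)
    show ?thesis
      using borel_representative_on_Ioi[OF m _ _ pos, of 1] by simp
  qed
  obtain w0 where w0 [measurable]: "w0 \<in> borel_measurable borel" "\<And>x. 0 < w0 x" "AE x in lborel. 0 < x \<longrightarrow> w x = w0 x"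
    using rep[OF w(1)] by blast
  obtain u0 where u0 [measurable]: "u0 \<in> borel_measurable borel" "\<And>x. 0 < u0 x" "AE x in lborel. 0 < x \<longrightarrow> u x = u0 x"
    using rep[OF u] by blast
  obtain v0 where v0 [measurable]: "v0 \<in> borel_measurable borel" "\<And>x. 0 < v0 x" "AE x in lborel. 0 < x \<longrightarrow> v x = v0 x"
    using rep[OF v] by blast
  have w_int: "(\<integral>\<^sup>+t\<in>{0<..<x}. ennreal (w t) \<partial>lborel) = (\<integral>\<^sup>+t\<in>{0<..<x}. ennreal (w0 t) \<partial>lborel)" for x
    using w0(3) by (intro nn_integral_cong_AE, eventually_elim) (auto split: split_indicator)
  interpret W: positive_density w0
    using w0 w(2) by unfold_locales (auto simp: nn_integral_completion w_int)
  let ?W = "primitive w0"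
  have cumul: "cumul w = ?W"
  proof
    fix x
    have "w \<in> borel_measurable (lebesgue_on {0<..<x})"
      using w(1) unfolding weight_def by (auto intro: measurable_restrict_mono)
    then have "(\<lambda>t. indicator {0<..<x} t *\<^sub>R w t) \<in> borel_measurable lebesgue"
      by (subst (asm) borel_measurable_restrict_space_iff) auto
    then have "cumul w x = enn2real (\<integral>\<^sup>+t. ennreal (indicator {0<..<x} t *\<^sub>R w t) \<partial>lebesgue)"
      unfolding cumul_def set_lebesgue_integral_def using w(1)
      by (intro integral_eq_nn_integral AE_I2) (auto simp: weight_def less_imp_le split: split_indicator)
    also have "(\<integral>\<^sup>+t. ennreal (indicator {0<..<x} t *\<^sub>R w t) \<partial>lebesgue) = (\<integral>\<^sup>+t\<in>{0<..<x}. ennreal (w t) \<partial>lborel)"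
      unfolding nn_integral_completion by (intro nn_integral_cong) (auto split: split_indicator)
    finally show "cumul w x = ?W x"
      unfolding w_int primitive_def .
  qed
  interpret W: unbounded_density w0
  proof
    fix y
    show "\<exists>x>0. y < ?W x"
    proof (rule ccontr)
      assume "\<not> ?thesis"
      then have le: "?W x \<le> y" if "0 < x" for x using that by auto
      have "(\<integral>\<^sup>+t\<in>{0<..}. ennreal (w t) \<partial>lborel) = (\<integral>\<^sup>+t\<in>{0<..}. ennreal (w0 t) \<partial>lborel)"
        using w0(3) by (intro nn_integral_cong_AE, eventually_elim) (auto split: split_indicator)
      also have "\<dots> = (SUP n. \<integral>\<^sup>+t\<in>{0<..<real n}. ennreal (w0 t) \<partial>lborel)"
        by (rule nn_integral_Ioi_SUP) (auto simp: mono_def reals_Archimedean2)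
      also have "\<dots> \<le> ennreal y"
      proof (rule SUP_least)
        fix n
        have "?W (real n) \<le> y"
          using le[of "real n"] order_trans[OF W.primitive_nonneg le[of 1]] by (cases "n = 0") auto
        then show "(\<integral>\<^sup>+t. ennreal (w0 t) * indicator {0<..<real n} t \<partial>lborel) \<le> ennreal y"
          by (simp add: W.ennreal_primitive[symmetric] ennreal_leI)
      qed
      finally show False using w(3) by (simp add: nn_integral_completion top_unique)
    qed
  qed
  define k where "k = (\<lambda>t. v0 t powr (1 - conj_exp p) * w0 t powr conj_exp p)"
  define \<sigma> where "\<sigma> x = (\<integral>\<^sup>+t\<in>{0<..<x}. ennreal (k t) \<partial>lborel)" for x
  have [measurable]: "k \<in> borel_measurable borel" unfolding k_def by measurable
  have lower: "epowr (\<sigma> t) ((s - 1) / p) *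
      epowr (\<integral>\<^sup>+x\<in>{t<..}. ennreal (u0 x) * epowr (\<sigma> x) (q * (p - s) / p) / ennreal (?W x powr q) \<partial>lborel) (1 / q)
    \<le> ennreal A" if "0 < t" for t
    using A_const_lower_bound[OF W.unbounded_density_axioms cumul u0(1) v0(1) u0(2,3) v0(2,3) that, of p s q]
    unfolding A(1) \<sigma>_def k_def .
  \<comment> \<open>If \<sigma> is infinite at t, it is infinite on the whole ray beyond t. Then the
    tail integral is nonzero while the factor in front of it is infinite, so the product cannot stay
    below \<open>A\<close>.\<close>
  have \<sigma>_fin: "\<sigma> t < \<infinity>" if t: "0 < t" for t
  proof (rule ccontr)
    assume "\<not> ?thesis"
    then have inf: "\<sigma> x = \<top>" if "t \<le> x" for x
    proof -
      have "\<sigma> t \<le> \<sigma> x"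
        unfolding \<sigma>_def using that by (intro nn_integral_mono) (auto split: split_indicator)
      then show ?thesis using \<open>\<not> \<sigma> t < \<infinity>\<close> by (simp add: less_top[symmetric] top_unique)
    qed
    have "(\<integral>\<^sup>+x\<in>{t<..}. ennreal (u0 x) * epowr (\<sigma> x) (q * (p - s) / p) / ennreal (?W x powr q) \<partial>lborel)
      = (\<integral>\<^sup>+x\<in>{t<..}. ennreal (u0 x) * \<top> / ennreal (?W x powr q) \<partial>lborel)"
      by (intro nn_integral_cong) (auto simp: inf split: split_indicator)
    also have "\<dots> \<noteq> 0"
      using u0(2) by (intro nn_integral_Ioi_nonzero) (auto simp: ennreal_mult_top less_le ennreal_divide_eq_0_iff)
    finally have "epowr (\<integral>\<^sup>+x\<in>{t<..}. ennreal (u0 x) * epowr (\<sigma> x) (q * (p - s) / p) / ennreal (?W x powr q) \<partial>lborel) (1 / q) \<noteq> 0"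
      by (auto simp: epowr_def enn2real_eq_0_iff)
    then show False
      using lower[OF t] inf[of t] by (simp add: ennreal_top_mult top_unique)
  qed
  interpret K: positive_density k
    using less_imp_neq[OF w0(2)] less_imp_neq[OF v0(2)] \<sigma>_fin
    by unfold_locales (auto simp: k_def \<sigma>_def zero_less_mult_iff)
  let ?K = "primitive k"
  have bound: "ennreal (?K t powr ((s - 1) / p)) *
        epowr (\<integral>\<^sup>+x\<in>{t<..}. ennreal (u0 x * ?K x powr (q * (p - s) / p) / ?W x powr q) \<partial>lborel) (1 / q)
        \<le> ennreal (A + e)" if t: "0 < t" for t
  proof -
    have \<sigma>: "\<sigma> x = ennreal (?K x)" for x
      by (simp add: \<sigma>_def K.ennreal_primitive)
    have "(\<integral>\<^sup>+x\<in>{t<..}. ennreal (u0 x) * epowr (\<sigma> x) (q * (p - s) / p) / ennreal (?W x powr q) \<partial>lborel)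
      = (\<integral>\<^sup>+x\<in>{t<..}. ennreal (u0 x * ?K x powr (q * (p - s) / p) / ?W x powr q) \<partial>lborel)"
    proof (intro nn_integral_cong)
      fix x
      show "ennreal (u0 x) * epowr (\<sigma> x) (q * (p - s) / p) / ennreal (?W x powr q) * indicator {t<..} x
        = ennreal (u0 x * ?K x powr (q * (p - s) / p) / ?W x powr q) * indicator {t<..} x"
        using t W.primitive_pos[of x] u0(2)[of x]
        by (auto simp: \<sigma> epowr_ennreal divide_ennreal less_imp_le simp flip: ennreal_mult split: split_indicator)
    qed
    then have "ennreal (?K t powr ((s - 1) / p)) *
        epowr (\<integral>\<^sup>+x\<in>{t<..}. ennreal (u0 x * ?K x powr (q * (p - s) / p) / ?W x powr q) \<partial>lborel) (1 / q) \<le> ennreal A"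
      using lower[OF t] by (simp add: \<sigma> epowr_ennreal)
    also have "\<dots> \<le> ennreal (A + e)" using e by (intro ennreal_leI) simp
    finally show ?thesis .
  qed
  show ?thesis
    unfolding wmean_ineq_def nn_integral_completion
  proof (intro allI impI)
    fix f :: "real \<Rightarrow> real"
    assume f: "f \<in> borel_measurable (lebesgue_on {0<..})" "\<forall>x>0. 0 \<le> f x" "wmean_defined a b g w f"
    have "\<exists>f0. f0 \<in> borel_measurable borel \<and> (\<forall>x. f0 x \<in> {0..}) \<and> (AE x in lborel. 0 < x \<longrightarrow> f x = f0 x)"
      by (rule borel_representative_on_Ioi[OF f(1), of _ 0]) (use f(2) in auto)
    then obtain f0 where f0: "f0 \<in> borel_measurable borel" "\<forall>x. f0 x \<in> {0..}" "AE x in lborel. 0 < x \<longrightarrow> f x = f0 x"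
      by blast
    have f0_nonneg: "0 \<le> f0 x" for x
      using f0(2) by simp
    let ?I = "\<lambda>x. \<integral>\<^sup>+t\<in>{0<..<x}. ennreal (w0 t * f0 t) \<partial>lborel"
    have I: "(\<integral>\<^sup>+t\<in>{0<..<x}. ennreal (w t * f t) \<partial>lborel) = ?I x" for x
      using w0(3) f0(3) by (intro nn_integral_cong_AE, eventually_elim) (auto split: split_indicator)
    \<comment> \<open>If w f is not integrable on (0,x), the right side is infinite because u is
      positive, and nothing has to be known about the mean. Otherwise this is Jensen's
      inequality.\<close>
    have pt: "ennreal (u x * wmean a b g w f x powr q) \<le> ennreal (u x) * epowr (?I x * ennreal (1 / ?W x)) q" if x: "0 < x" for x
    proof (cases "?I x = \<top>")
      case True
      moreover have "0 < u x" using u x by (simp add: weight_def)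
      ultimately show ?thesis
        using W.primitive_pos[OF x] by (simp add: ennreal_top_mult ennreal_mult_top)
    next
      case False
      have m: "0 \<le> wmean a b g w f x" "ennreal (wmean a b g w f x) \<le> ?I x * ennreal (1 / ?W x)"
        using wmean_le_mean[OF w(1) _ _ g f(1) _ f(3) _ x] W.primitive_pos[OF x] f(2) False
        by (auto simp: I cumul w_int W.ennreal_primitive less_top)
      have "ennreal (u x * wmean a b g w f x powr q) = ennreal (u x) * epowr (ennreal (wmean a b g w f x)) q"
        using m(1) u x by (simp add: epowr_ennreal ennreal_mult weight_def less_imp_le)
      also have "\<dots> \<le> ennreal (u x) * epowr (?I x * ennreal (1 / ?W x)) q"
        using m(2) par by (intro mult_left_mono epowr_mono) auto
      finally show ?thesis .
    qed
    have "(\<integral>\<^sup>+x\<in>{0<..}. ennreal (u x * wmean a b g w f x powr q) \<partial>lborel)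
      \<le> (\<integral>\<^sup>+x\<in>{0<..}. ennreal (u0 x) * epowr (?I x * ennreal (1 / ?W x)) q \<partial>lborel)"
      using u0(3)
    proof (intro nn_integral_mono_AE, eventually_elim)
      case (elim x)
      then show ?case using pt[of x] by (auto split: split_indicator)
    qed
    then have "epowr (\<integral>\<^sup>+x\<in>{0<..}. ennreal (u x * wmean a b g w f x powr q) \<partial>lborel) (1 / q)
      \<le> epowr (\<integral>\<^sup>+x\<in>{0<..}. ennreal (u0 x) * epowr (?I x * ennreal (1 / ?W x)) q \<partial>lborel) (1 / q)"
      using par by (intro epowr_mono) auto
    also have "\<dots> \<le> ennreal (((p - 1) / (p - s)) powr (1 / conj_exp p) * (A + e)) *
        epowr (\<integral>\<^sup>+x\<in>{0<..}. ennreal (v0 x * f0 x powr p) \<partial>lborel) (1 / p)"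
      using bound A(2) e par K.positive_density_axioms W.positive_density_axioms u0 v0 f0(1) f0_nonneg
      unfolding k_def by (intro weighted_hardy_inequality) auto
    also have "(\<integral>\<^sup>+x\<in>{0<..}. ennreal (v0 x * f0 x powr p) \<partial>lborel) = (\<integral>\<^sup>+x\<in>{0<..}. ennreal (v x * f x powr p) \<partial>lborel)"
      using v0(3) f0(3) by (intro nn_integral_cong_AE, eventually_elim) (auto split: split_indicator)
    finally show "epowr (\<integral>\<^sup>+x\<in>{0<..}. ennreal (u x * wmean a b g w f x powr q) \<partial>lborel) (1 / q)
        \<le> ennreal (((p - 1) / (p - s)) powr (1 / conj_exp p) * (A + e)) *
          epowr (\<integral>\<^sup>+x\<in>{0<..}. ennreal (v x * f x powr p) \<partial>lborel) (1 / p)" .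
  qed
qed

theorem theorem5p1:
  fixes p q s :: real and a b :: ereal and g w u v U V :: "real \<Rightarrow> real"
  assumes "1 < p" and "p \<le> q" and "1 < s" and "s < p"
    and "a < b"
    and "continuous_on (einterval a b) g"
    and "(convex_on (einterval a b) g \<and> strict_antimono_on (einterval a b) g) \<or>
         (concave_on (einterval a b) g \<and> strict_mono_on (einterval a b) g)"
    and "weight w"
    and "\<And>x. x > 0 \<Longrightarrow> (\<integral>\<^sup>+t\<in>{0<..<x}. ennreal (w t) \<partial>lebesgue) < \<infinity>"
    and "(\<integral>\<^sup>+t\<in>{0<..}. ennreal (w t) \<partial>lebesgue) = \<infinity>"
    and "weight u" and "weight v"
    and "U = transport w u" and "V = transport w v"
  shows "(A_const p q U V s < \<infinity> \<longrightarrow> (\<exists>C>0. wmean_ineq p q a b g w u v C)) \<and>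
         best_const p q a b g w u v
           \<le> (INF r\<in>{1<..<p}.
                 ennreal (((p - 1) / (p - r)) powr (1 / conj_exp p)) * A_const p q U V r)"
proof -
  define \<kappa> where "\<kappa> r = ((p - 1) / (p - r)) powr (1 / conj_exp p)" for r
  have \<kappa>: "0 < \<kappa> r" if "r < p" for r
    using assms(1) that by (simp add: \<kappa>_def)
  have ineq: "wmean_ineq p q a b g w u v (\<kappa> r * (A + e))"
    if "1 < r" "r < p" "A_const p q U V r = ennreal A" "0 \<le> A" "0 < e" for r A e
    using wmean_ineq_of_A_const[OF assms(1,2) that(1,2,5) assms(6-12)] that(3,4)
    unfolding assms(13,14) \<kappa>_def by blast
  show ?thesis
  proof (intro conjI impI INF_greatest)
    assume "A_const p q U V s < \<infinity>"
    then obtain A where A: "A_const p q U V s = ennreal A" "0 \<le> A"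
      by (cases "A_const p q U V s") auto
    have "0 < \<kappa> s * (A + 1)"
      using \<kappa>[OF assms(4)] A by (intro mult_pos_pos) auto
    then show "\<exists>C>0. wmean_ineq p q a b g w u v C"
      using ineq[OF assms(3,4) A zero_less_one] by blast
  next
    fix r assume r: "r \<in> {1<..<p}"
    have "best_const p q a b g w u v \<le> ennreal (\<kappa> r) * A_const p q U V r"
    proof (cases "A_const p q U V r")
      case top
      then show ?thesis using \<kappa>[of r] r by (simp add: ennreal_mult_top)
    next
      case (real A)
      have *: "best_const p q a b g w u v \<le> ennreal (\<kappa> r * A) + ennreal d" if d: "0 < d" for d
      proof -
        \<comment> \<open>Scaled so that the constant overshoots by exactly
          \<open>d\<close>.\<close>
        define e where "e = d / \<kappa> r"
        have e: "0 < e" "\<kappa> r * (A + e) = \<kappa> r * A + d"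
          using d \<kappa>[of r] r by (auto simp: e_def field_simps)
        have pos: "0 < \<kappa> r * (A + e)"
          using \<kappa>[of r] r real e(1) by (intro mult_pos_pos) auto
        have "best_const p q a b g w u v \<le> ennreal (\<kappa> r * (A + e))"
          unfolding best_const_def
          using ineq[of r A e] r real e(1) pos by (intro Inf_lower) auto
        then show ?thesis
          unfolding e(2) using \<kappa>[of r] r real d by simp
      qed
      have "best_const p q a b g w u v \<le> ennreal (\<kappa> r * A)"
        by (rule ennreal_le_epsilon) (rule *)
      then show ?thesis
        using real \<kappa>[of r] r by (simp add: ennreal_mult)
    qed
    then show "best_const p q a b g w u v \<le> ennreal (((p - 1) / (p - r)) powr (1 / conj_exp p)) * A_const p q U V r"
      unfolding \<kappa>_def .
  qed
qed

end
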